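(* Let $A$ be a C*-algebra. The compactly supported states $\mathcal S_c(A)$ on $A$ are weak-$*$-dense in the set $\mathcal S(A)$ of all states on $A$.
   Context: A state $\psi$ on $A$ is compactly supported if there exists a nonzero $a\in A$ such that $\psi(a)=\|a\|$. $\mathcal S_c(A)$ denotes the set of compactly supported states. *)

theory Defs
  imports "HOL-Analysis.Analysis"
begin

class complex_vector = real_vector +
  fixes scaleC :: "complex \<Rightarrow> 'a \<Rightarrow> 'a"  (infixr \<open>*\<^sub>C\<close> 75)
  assumes scaleC_add_right: "c *\<^sub>C (x + y) = c *\<^sub>C x + c *\<^sub>C y"
    and scaleC_add_left: "(c + d) *\<^sub>C x = c *\<^sub>C x + d *\<^sub>C x"
    and scaleC_scaleC: "c *\<^sub>C d *\<^sub>C x = (c * d) *\<^sub>C x"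
    and scaleC_one: "1 *\<^sub>C x = x"
    and scaleC_of_real: "complex_of_real r *\<^sub>C x = r *\<^sub>R x"

text \<open>No unit is assumed, and the zero algebra is allowed.\<close>

class complex_banach_algebra = complex_vector + real_normed_algebra + banach +
  assumes norm_scaleC: "norm (c *\<^sub>C x) = cmod c * norm x"
    and mult_scaleC_left: "(c *\<^sub>C x) * y = c *\<^sub>C (x * y)"
    and mult_scaleC_right: "x * (c *\<^sub>C y) = c *\<^sub>C (x * y)"

class cstar_algebra = complex_banach_algebra +
  fixes star :: "'a \<Rightarrow> 'a"
  assumes star_star: "star (star x) = x"
    and star_add: "star (x + y) = star x + star y"
    and star_scaleC: "star (c *\<^sub>C x) = cnj c *\<^sub>C star x"
    and star_mult: "star (x * y) = star y * star x"
    and cstar_identity: "norm (star x * x) = (norm x)\<^sup>2"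

definition continuous_dual :: "('a::cstar_algebra \<Rightarrow> complex) set" where
  "continuous_dual = {\<phi>. bounded_linear \<phi> \<and> (\<forall>c x. \<phi> (c *\<^sub>C x) = c * \<phi> x)}"

definition positive_functional :: "('a::cstar_algebra \<Rightarrow> complex) \<Rightarrow> bool" where
  "positive_functional \<phi> \<longleftrightarrow> (\<forall>x. \<phi> (star x * x) \<in> \<real>\<^sub>\<ge>\<^sub>0)"

definition states :: "('a::cstar_algebra \<Rightarrow> complex) set" where
  "states = {\<psi> \<in> continuous_dual. positive_functional \<psi> \<and> onorm \<psi> = 1}"

definition compactly_supported_states :: "('a::cstar_algebra \<Rightarrow> complex) set" where
  "compactly_supported_states = {\<psi> \<in> states. \<exists>a. a \<noteq> 0 \<and> \<psi> a = complex_of_real (norm a)}"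

text \<open>The coarsest topology on the dual for which all evaluations are continuous.\<close>

definition weak_star_topology :: "('a::cstar_algebra \<Rightarrow> complex) topology" where
  "weak_star_topology = topology_generated_by
     {{\<phi> \<in> continuous_dual. \<phi> a \<in> U} | a U. open U}"

end

theory Submission
  imports Defs
begin

text \<open>
  In the commutative case \<open>A = C\<^sub>0(X)\<close> a state is a probability measure, it is compactly supported in
  the present sense iff its support is compact, and the density follows by cutting a measure off to
  a large compact set and rescaling. The same works in general: if \<open>b\<close> is a self-adjoint contraction
  with \<open>h * b = b\<close> for some contraction \<open>h\<close>, then
  \<open>\<phi> x = \<psi> (b * x * b) / \<psi> (b * b)\<close> is a state with \<open>\<phi> h = 1 = \<parallel>h\<parallel>\<close>
  (\<open>compressed_state\<close>), and by the Cauchy-Schwarz inequality it is close to \<open>\<psi>\<close>, even in norm, as soon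
  as \<open>\<psi> ((1 - b)\<^sup>2)\<close> is small (\<open>compression_close\<close>). Hence the compactly supported states are norm
  dense among the states (\<open>compactly_supported_states_norm_dense\<close>).

  What has to be produced is the cut-off \<open>b\<close> with its local unit \<open>h\<close>. Choose \<open>a\<close> of norm one on which
  \<open>\<psi>\<close> nearly attains its norm. With \<open>s = a * star a\<close>, functional calculus gives
  functions \<open>y, h\<close> of \<open>s\<close> with values in \<open>[0, 1]\<close>, vanishing at \<open>0\<close>, such that \<open>h = 1\<close> where
  \<open>y \<noteq> 0\<close> and \<open>y = 1\<close> off a neighbourhood of \<open>0\<close>; then \<open>y * a\<close> is close to \<open>a\<close>
  (\<open>approximate_unit_with_local_unit\<close>), and \<open>b = y\<^sup>2\<close> satisfies all demands. The same approximate
  units show that \<open>\<psi>\<close> extends to a positive functional on the unitization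
  (\<open>positive_linear_functional_unitized\<close>).

  Spectra and the Gelfand transform are avoided. In a unital C*-algebra the binomial
  series of \<open>sqrt (1 - x)\<close> converges on the closed unit ball, and that alone yields the
  order theory of the real commutative algebra of functions of \<open>s\<close>: an element \<open>x\<close> is a square
  iff \<open>\<parallel>M - x\<parallel> \<le> M\<close> for \<open>M \<ge> \<parallel>x\<parallel>\<close> (\<open>squares_ofI\<close>, \<open>squares_ofD\<close>), and every element is a
  difference of two orthogonal squares (\<open>orthogonal_decomposition\<close>). The cut-offs are positive parts
  of affine expressions (\<open>nested_cutoffs\<close>).
\<close>

section \<open>Elementary consequences of the axioms\<close>

lemma scaleC_minus_left: "(- c) *\<^sub>C (x::'a::complex_vector) = - (c *\<^sub>C x)"
proof -
  have "0 *\<^sub>C x = 0"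
    using scaleC_add_left[of 0 0 x] by simp
  then show ?thesis
    using scaleC_add_left[of "-c" c x] by (simp add: eq_neg_iff_add_eq_0)
qed

lemma scaleC_zero_left [simp]: "0 *\<^sub>C (x::'a::complex_vector) = 0"
  using scaleC_add_left[of 0 0 x] by simp

lemma scaleC_zero_right [simp]: "c *\<^sub>C (0::'a::complex_vector) = 0"
  using scaleC_add_right[of c 0 0] by simp

lemma scaleC_diff_right: "c *\<^sub>C (x - y) = c *\<^sub>C x - c *\<^sub>C (y::'a::complex_vector)"
  using scaleC_add_right[of c "x - y" y] by (simp add: algebra_simps)

lemma scaleC_scaleR: "c *\<^sub>C r *\<^sub>R x = r *\<^sub>R c *\<^sub>C (x::'a::complex_vector)"
  by (metis scaleC_of_real scaleC_scaleC mult.commute)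

lemma bounded_linear_scaleC_right: "bounded_linear (\<lambda>x::'a::complex_banach_algebra. c *\<^sub>C x)"
  by (rule bounded_linear_intro[where K = "cmod c"])
    (simp_all add: scaleC_add_right scaleC_scaleR norm_scaleC mult.commute)

lemma norm_le_norm_star: "norm x \<le> norm (star (x::'a::cstar_algebra))"
proof (cases "x = 0")
  case False
  have "norm x * norm x \<le> norm (star x) * norm x"
    using cstar_identity[of x] norm_mult_ineq[of "star x" x] by (simp add: power2_eq_square)
  then show ?thesis using False by simp
qed simp

lemma norm_star [simp]: "norm (star x) = norm (x::'a::cstar_algebra)"
  using norm_le_norm_star[of x] norm_le_norm_star[of "star x"] by (simp add: star_star)

lemma star_scaleR: "star (r *\<^sub>R x) = r *\<^sub>R star (x::'a::cstar_algebra)"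
  using star_scaleC[of "complex_of_real r" x] by (simp add: scaleC_of_real)

lemma bounded_linear_star: "bounded_linear (star :: 'a::cstar_algebra \<Rightarrow> 'a)"
  by (rule bounded_linear_intro[where K = 1]) (simp_all add: star_add star_scaleR)

lemma star_diff: "star (x - y) = star x - star (y::'a::cstar_algebra)"
  by (rule linear_diff[OF bounded_linear.linear[OF bounded_linear_star]])

lemma star_one [simp]: "star (1::'a::{cstar_algebra,real_normed_algebra_1}) = 1"
  by (metis mult_1 mult_1_right star_mult star_star)

lemma star_power: "star (x ^ n) = star (x::'a::{cstar_algebra,real_normed_algebra_1}) ^ n"
  by (induction n) (simp_all add: star_mult power_commutes)

lemma norm_selfadjoint_square:
  "star x = x \<Longrightarrow> norm (x * x) = (norm (x::'a::cstar_algebra))\<^sup>2"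
  using cstar_identity[of x] by simp

section \<open>The unitization\<close>

datatype 'a unitization = Unitization (algebra_part: 'a) (scalar_part: complex)

abbreviation embed :: "'a::cstar_algebra \<Rightarrow> 'a unitization" where
  "embed x \<equiv> Unitization x 0"

definition unitization_action :: "'a::cstar_algebra unitization \<Rightarrow> 'a \<Rightarrow> 'a" where
  "unitization_action X y = algebra_part X * y + scalar_part X *\<^sub>C y"

lemma bounded_linear_unitization_action: "bounded_linear (unitization_action X)"
  unfolding unitization_action_def
  by (intro bounded_linear_add bounded_linear_mult_right bounded_linear_scaleC_right)

instantiation unitization :: (cstar_algebra) "{real_algebra_1, complex_vector}"
begin

definition "0 = Unitization 0 0"
definition "1 = Unitization 0 1"
definition "X + Y = Unitization (algebra_part X + algebra_part Y) (scalar_part X + scalar_part Y)"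
definition "- X = Unitization (- algebra_part X) (- scalar_part X)"
definition "X - Y = Unitization (algebra_part X - algebra_part Y) (scalar_part X - scalar_part Y)"
definition "r *\<^sub>R X = Unitization (r *\<^sub>R algebra_part X) (r *\<^sub>R scalar_part X)"
definition "c *\<^sub>C X = Unitization (c *\<^sub>C algebra_part X) (c * scalar_part X)"
definition "X * Y = Unitization
  (algebra_part X * algebra_part Y + scalar_part X *\<^sub>C algebra_part Y + scalar_part Y *\<^sub>C algebra_part X)
  (scalar_part X * scalar_part Y)"

instance
proof
  fix X Y Z :: "'a unitization" and a b :: real and c d :: complex
  show "X * Y * Z = X * (Y * Z)"
    by (simp add: times_unitization_def distrib_left distrib_right scaleC_add_right scaleC_scaleC
        mult_scaleC_left mult_scaleC_right mult_ac)
  show "(X + Y) * Z = X * Z + Y * Z" "X * (Y + Z) = X * Y + X * Z"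
    by (simp_all add: times_unitization_def plus_unitization_def distrib_left distrib_right
        scaleC_add_right scaleC_add_left)
  show "(0::'a unitization) \<noteq> 1"
    by (simp add: zero_unitization_def one_unitization_def)
qed (auto simp: zero_unitization_def one_unitization_def plus_unitization_def uminus_unitization_def
    minus_unitization_def scaleR_unitization_def scaleC_unitization_def times_unitization_def
    algebra_simps scaleC_add_left scaleC_add_right scaleC_scaleC scaleC_one scaleC_of_real[symmetric]
    mult_scaleC_left mult_scaleC_right scaleR_conv_of_real[of _ "_ :: complex"] intro!: unitization.expand)
end

lemma algebra_part_simps [simp]:
  "algebra_part 0 = 0" "algebra_part 1 = 0"
  "algebra_part (X + Y) = algebra_part X + algebra_part Y"
  "algebra_part (- X) = - algebra_part X"
  "algebra_part (X - Y) = algebra_part X - algebra_part Y"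
  "algebra_part (r *\<^sub>R X) = r *\<^sub>R algebra_part X"
  "algebra_part (c *\<^sub>C X) = c *\<^sub>C algebra_part X"
  "algebra_part (X * Y) = algebra_part X * algebra_part Y +
     scalar_part X *\<^sub>C algebra_part Y + scalar_part Y *\<^sub>C algebra_part X"
  by (simp_all add: zero_unitization_def one_unitization_def plus_unitization_def
      uminus_unitization_def minus_unitization_def scaleR_unitization_def scaleC_unitization_def
      times_unitization_def)

lemma scalar_part_simps [simp]:
  "scalar_part 0 = 0" "scalar_part 1 = 1"
  "scalar_part (X + Y) = scalar_part X + scalar_part Y"
  "scalar_part (- X) = - scalar_part X"
  "scalar_part (X - Y) = scalar_part X - scalar_part Y"
  "scalar_part (r *\<^sub>R X) = r *\<^sub>R scalar_part X"
  "scalar_part (c *\<^sub>C X) = c * scalar_part X"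
  "scalar_part (X * Y) = scalar_part X * scalar_part Y"
  by (simp_all add: zero_unitization_def one_unitization_def plus_unitization_def
      uminus_unitization_def minus_unitization_def scaleR_unitization_def scaleC_unitization_def
      times_unitization_def)

lemma unitization_action_mult:
  "unitization_action (X * Y) z = unitization_action X (unitization_action Y z)"
  by (simp add: unitization_action_def algebra_simps scaleC_add_right scaleC_scaleC
      mult_scaleC_left mult_scaleC_right)

lemma unitization_action_add:
  "unitization_action (X + Y) z = unitization_action X z + unitization_action Y z"
  by (simp add: unitization_action_def algebra_simps scaleC_add_left)

lemma unitization_action_scaleC:
  "unitization_action (c *\<^sub>C X) z = c *\<^sub>C unitization_action X z"
  by (simp add: unitization_action_def scaleC_add_right scaleC_scaleC mult_scaleC_left)

text \<open>Acting by left multiplication on \<open>A\<close> alone gives merely a seminorm when \<open>A\<close> already has a unit,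
  and zero when \<open>A\<close> is trivial. The norm chosen is that of the action on \<open>A \<oplus> \<complex>\<close>, the scalar part
  acting on the second summand; it is a C*-norm with \<open>\<parallel>1\<parallel> = 1\<close> in every case.\<close>

instantiation unitization :: (cstar_algebra) real_normed_algebra_1
begin

definition "norm X = max (onorm (unitization_action X)) (cmod (scalar_part X))"
definition "dist X Y = norm (X - Y :: 'a unitization)"
definition "sgn X = X /\<^sub>R norm (X :: 'a unitization)"
definition [code del]:
  "uniformity = (INF e\<in>{0<..}. principal {(X, Y). dist X (Y :: 'a unitization) < e})"
definition [code del]:
  "open U \<longleftrightarrow> (\<forall>X\<in>U. eventually (\<lambda>(X', Y). X' = X \<longrightarrow> Y \<in> U) (uniformity :: ('a unitization \<times> _) filter))"

lemma norm_scalar_part_le: "cmod (scalar_part X) \<le> norm (X :: 'a unitization)"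
  by (simp add: norm_unitization_def)

lemma norm_unitization_action_le:
  "norm (unitization_action X y) \<le> norm X * norm (y :: 'a)"
proof -
  have "norm (unitization_action X y) \<le> onorm (unitization_action X) * norm y"
    by (rule onorm[OF bounded_linear_unitization_action])
  also have "\<dots> \<le> norm X * norm y"
    by (intro mult_right_mono) (simp_all add: norm_unitization_def)
  finally show ?thesis .
qed

lemma norm_unitization_leI:
  assumes "\<And>y. norm (unitization_action X y) \<le> K * norm (y :: 'a)" "cmod (scalar_part X) \<le> K"
  shows "norm X \<le> K"
proof -
  have "0 \<le> K" using assms(2) norm_ge_zero order_trans by blast
  then show ?thesis
    using assms onorm_bound[of K "unitization_action X"] by (simp add: norm_unitization_def)
qed

instance
proof
  fix X Y :: "'a unitization" and r :: real
  have nonneg: "0 \<le> norm X" for X :: "'a unitization"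
    by (simp add: norm_unitization_def max.coboundedI2)
  show tri: "norm (X + Y) \<le> norm X + norm Y"
  proof (rule norm_unitization_leI)
    fix y
    show "norm (unitization_action (X + Y) y) \<le> (norm X + norm Y) * norm y"
      unfolding unitization_action_add distrib_right
      by (intro norm_triangle_le add_mono norm_unitization_action_le)
  qed (auto intro!: norm_triangle_le add_mono norm_scalar_part_le)
  show "norm (X * Y) \<le> norm X * norm Y"
  proof (rule norm_unitization_leI)
    fix y
    have "norm (unitization_action (X * Y) y) \<le> norm X * norm (unitization_action Y y)"
      unfolding unitization_action_mult by (rule norm_unitization_action_le)
    also have "\<dots> \<le> norm X * (norm Y * norm y)"
      by (intro mult_left_mono norm_unitization_action_le nonneg)
    finally show "norm (unitization_action (X * Y) y) \<le> norm X * norm Y * norm y"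
      by (simp add: mult.assoc)
  qed (auto simp: norm_mult intro!: mult_mono norm_scalar_part_le nonneg)
  have scale: "norm (r *\<^sub>R X) \<le> \<bar>r\<bar> * norm X" for r and X :: "'a unitization"
  proof (rule norm_unitization_leI)
    fix y
    have "unitization_action (r *\<^sub>R X) y = r *\<^sub>R unitization_action X y"
      using unitization_action_scaleC[of "complex_of_real r" X y] by (simp add: scaleC_of_real)
    then show "norm (unitization_action (r *\<^sub>R X) y) \<le> \<bar>r\<bar> * norm X * norm y"
      using norm_unitization_action_le[of X y] by (simp add: mult.assoc mult_left_mono)
  qed (auto intro!: mult_left_mono norm_scalar_part_le)
  show "norm (r *\<^sub>R X) = \<bar>r\<bar> * norm X"
  proof (cases "r = 0")
    case True
    then show ?thesis using scale[of r X] nonneg[of "r *\<^sub>R X"] by simp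
  next
    case False
    then have "norm X \<le> norm (r *\<^sub>R X) / \<bar>r\<bar>"
      using scale[of "1 / r" "r *\<^sub>R X"] by (simp add: abs_inverse divide_inverse mult.commute)
    then have "\<bar>r\<bar> * norm X \<le> norm (r *\<^sub>R X)"
      using False by (simp add: field_simps)
    then show ?thesis using scale[of r X] by simp
  qed
  show "norm X = 0 \<longleftrightarrow> X = 0"
  proof
    assume *: "norm X = 0"
    then have s: "scalar_part X = 0" using norm_scalar_part_le[of X] by simp
    have "norm (algebra_part X * star (algebra_part X)) \<le> 0"
      using norm_unitization_action_le[of X "star (algebra_part X)"] * s
      by (simp add: unitization_action_def)
    then have "algebra_part X = 0"
      using cstar_identity[of "star (algebra_part X)"] by (simp add: star_star)
    with s show "X = 0" by (intro unitization.expand) simp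
  next
    assume "X = 0"
    moreover have "unitization_action (0 :: 'a unitization) = (\<lambda>y. 0)"
      by (simp add: unitization_action_def fun_eq_iff)
    ultimately show "norm X = 0" by (simp add: norm_unitization_def onorm_zero)
  qed
  show "norm (1 :: 'a unitization) = 1"
  proof (rule antisym)
    show "norm (1 :: 'a unitization) \<le> 1"
      by (rule norm_unitization_leI) (simp_all add: unitization_action_def scaleC_one)
    show "1 \<le> norm (1 :: 'a unitization)"
      using norm_scalar_part_le[of "1 :: 'a unitization"] by simp
  qed
qed (simp_all add: dist_unitization_def sgn_unitization_def uniformity_unitization_def
    open_unitization_def)
end

text \<open>Testing the action of \<open>x\<close> on \<open>star x\<close> shows, by the C*-identity, that left multiplication loses no
  norm.\<close>

lemma norm_embed [simp]: "norm (embed x) = norm x"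
proof (rule antisym)
  show "norm (embed x) \<le> norm x"
    by (rule norm_unitization_leI) (simp_all add: unitization_action_def norm_mult_ineq)
  have "norm x * norm x = norm (unitization_action (embed x) (star x))"
    using cstar_identity[of "star x"] by (simp add: star_star unitization_action_def power2_eq_square)
  also have "\<dots> \<le> norm (embed x) * norm x"
    using norm_unitization_action_le[of "embed x" "star x"] by simp
  finally show "norm x \<le> norm (embed x)"
    by (cases "x = 0") simp_all
qed

lemma norm_scalar_unitization: "norm (Unitization (0::'a::cstar_algebra) c) = cmod c"
proof (rule antisym)
  show "norm (Unitization (0::'a) c) \<le> cmod c"
    by (rule norm_unitization_leI) (simp_all add: unitization_action_def norm_scaleC)
  show "cmod c \<le> norm (Unitization (0::'a) c)"
    using norm_scalar_part_le[of "Unitization (0::'a) c"] by simp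
qed

text \<open>Convergence in the unitization is therefore convergence of both parts, whence completeness.\<close>

lemma norm_algebra_part_le: "norm (algebra_part X) \<le> 2 * norm X"
proof -
  have "embed (algebra_part X) = X - Unitization 0 (scalar_part X)"
    by (intro unitization.expand) simp
  then have "norm (embed (algebra_part X)) \<le> norm X + norm (Unitization (0::'a) (scalar_part X))"
    by (metis norm_triangle_ineq4)
  then show ?thesis
    using norm_scalar_part_le[of X] by (simp add: norm_scalar_unitization)
qed

instance unitization :: (cstar_algebra) banach
proof
  fix X :: "nat \<Rightarrow> 'a unitization"
  assume "Cauchy X"
  have "bounded_linear (algebra_part :: 'a unitization \<Rightarrow> 'a)"
    by (rule bounded_linear_intro[where K = 2]) (simp_all add: norm_algebra_part_le[unfolded mult.commute[of 2]])
  then have "Cauchy (\<lambda>n. algebra_part (X n))"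
    using \<open>Cauchy X\<close> by (rule bounded_linear.Cauchy)
  then obtain x where x: "(\<lambda>n. algebra_part (X n)) \<longlonglongrightarrow> x"
    by (meson Cauchy_convergent convergentD)
  have "bounded_linear (scalar_part :: 'a unitization \<Rightarrow> complex)"
    by (rule bounded_linear_intro[where K = 1]) (simp_all add: norm_scalar_part_le)
  then have "Cauchy (\<lambda>n. scalar_part (X n))"
    using \<open>Cauchy X\<close> by (rule bounded_linear.Cauchy)
  then obtain l where l: "(\<lambda>n. scalar_part (X n)) \<longlonglongrightarrow> l"
    by (meson Cauchy_convergent convergentD)
  have "X \<longlonglongrightarrow> Unitization x l"
  proof (rule LIM_zero_cancel, rule Lim_null_comparison)
    have "norm (X n - Unitization x l) \<le> norm (algebra_part (X n) - x) + cmod (scalar_part (X n) - l)"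
      for n
    proof -
      have "X n - Unitization x l
          = embed (algebra_part (X n) - x) + Unitization 0 (scalar_part (X n) - l)"
        by (intro unitization.expand) simp
      then show ?thesis
        by (metis norm_triangle_ineq norm_embed norm_scalar_unitization)
    qed
    then show "\<forall>\<^sub>F n in sequentially. norm (X n - Unitization x l)
        \<le> norm (algebra_part (X n) - x) + cmod (scalar_part (X n) - l)"
      by simp
    show "(\<lambda>n. norm (algebra_part (X n) - x) + cmod (scalar_part (X n) - l)) \<longlonglongrightarrow> 0"
      using tendsto_add[OF tendsto_norm_zero[OF LIM_zero[OF x]] tendsto_norm_zero[OF LIM_zero[OF l]]]
      by simp
  qed
  then show "convergent X" by (rule convergentI)
qed

instantiation unitization :: (cstar_algebra) cstar_algebra
begin

definition "star X = Unitization (star (algebra_part X)) (cnj (scalar_part X))"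

instance
proof
  fix X Y :: "'a unitization" and c :: complex
  show "norm (c *\<^sub>C X) = cmod c * norm X"
  proof -
    have le: "norm (c *\<^sub>C X) \<le> cmod c * norm X" for c and X :: "'a unitization"
    proof (rule norm_unitization_leI)
      fix y
      show "norm (unitization_action (c *\<^sub>C X) y) \<le> cmod c * norm X * norm y"
        using norm_unitization_action_le[of X y]
        by (simp add: unitization_action_scaleC norm_scaleC mult.assoc mult_left_mono)
    qed (auto simp: norm_mult intro!: mult_left_mono norm_scalar_part_le)
    show ?thesis
    proof (cases "c = 0")
      case False
      then have "norm X \<le> norm (c *\<^sub>C X) / cmod c"
        using le[of "1 / c" "c *\<^sub>C X"]
        by (simp add: scaleC_scaleC scaleC_one norm_inverse divide_inverse mult.commute)
      then have "cmod c * norm X \<le> norm (c *\<^sub>C X)"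
        using False by (simp add: field_simps)
      then show ?thesis using le[of c X] by simp
    qed simp
  qed
  show "star (star X) = X" "star (X + Y) = star X + star Y" "star (c *\<^sub>C X) = cnj c *\<^sub>C star X"
    "star (X * Y) = star Y * star X"
    by (auto intro!: unitization.expand
        simp: star_unitization_def star_star star_add star_scaleC star_mult)
  show "(c *\<^sub>C X) * Y = c *\<^sub>C (X * Y)" "X * (c *\<^sub>C Y) = c *\<^sub>C (X * Y)"
    by (auto intro!: unitization.expand simp: scaleC_add_right scaleC_scaleC mult_scaleC_left
        mult_scaleC_right mult_ac)
  have square_le: "(norm X)\<^sup>2 \<le> norm (star X * X)" for X :: "'a unitization"
  proof -
    let ?N = "norm (star X * X)"
    have "norm X \<le> sqrt ?N"
    proof (rule norm_unitization_leI)
      fix y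
      have "star (unitization_action X y) * unitization_action X y
          = star y * unitization_action (star X * X) y"
        by (simp add: unitization_action_def star_unitization_def star_add star_mult star_scaleC
            algebra_simps scaleC_add_right mult_scaleC_left mult_scaleC_right scaleC_scaleC)
      then have "(norm (unitization_action X y))\<^sup>2 = norm (star y * unitization_action (star X * X) y)"
        using cstar_identity[of "unitization_action X y"] by simp
      also have "\<dots> \<le> norm y * (?N * norm y)"
        by (rule order_trans[OF norm_mult_ineq])
          (simp add: mult_left_mono norm_unitization_action_le)
      also have "\<dots> = (sqrt ?N * norm y)\<^sup>2"
        by (simp add: power2_eq_square)
      finally show "norm (unitization_action X y) \<le> sqrt ?N * norm y"
        by (rule power2_le_imp_le) simp
      have "(cmod (scalar_part X))\<^sup>2 \<le> ?N"
        using norm_scalar_part_le[of "star X * X"]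
        by (simp add: star_unitization_def norm_mult power2_eq_square)
      then show "cmod (scalar_part X) \<le> sqrt ?N" by (rule real_le_rsqrt)
    qed
    then have "(norm X)\<^sup>2 \<le> (sqrt ?N)\<^sup>2" by (rule power_mono) simp
    then show ?thesis by simp
  qed
  have star_le: "norm X \<le> norm (star X)" for X :: "'a unitization"
  proof (cases "X = 0")
    case False
    have "norm X * norm X \<le> norm (star X) * norm X"
      using square_le[of X] norm_mult_ineq[of "star X" X] by (simp add: power2_eq_square)
    then show ?thesis using False by simp
  qed simp
  have "norm (star X) \<le> norm X"
    using star_le[of "star X"] by (simp add: star_unitization_def star_star)
  then have "norm (star X) * norm X \<le> norm X * norm X"
    by (rule mult_right_mono) simp
  then have "norm (star X * X) \<le> (norm X)\<^sup>2"
    using norm_mult_ineq[of "star X" X] unfolding power2_eq_square by linarith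
  then show "norm (star X * X) = (norm X)\<^sup>2" using square_le[of X] by simp
qed
end

lemma unitization_star_simps [simp]:
  "algebra_part (star X) = star (algebra_part X)" "scalar_part (star X) = cnj (scalar_part X)"
  by (simp_all add: star_unitization_def)

section \<open>Square roots by the binomial series\<close>

text \<open>The Taylor coefficients of \<open>sqrt (1 - t)\<close>. All but the first are nonpositive and the partial sums
  stay nonnegative, so the series converges absolutely on the closed unit ball, and all terms
  after the first have total norm at most one.\<close>

definition sqrt_coeff :: "nat \<Rightarrow> real" where
  "sqrt_coeff n = (-1) ^ n * ((1 / 2) gchoose n)"

lemma sqrt_coeff_0 [simp]: "sqrt_coeff 0 = 1"
  by (simp add: sqrt_coeff_def)

lemma gbinomial_alternating_pochhammer:
  "(-1) ^ n * (a gchoose n) = pochhammer (- a) n / fact n" for a :: real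
  by (simp add: gbinomial_pochhammer mult.assoc[symmetric] flip: power_add)

lemma sqrt_coeff_Suc_nonpos: "sqrt_coeff (Suc n) \<le> 0"
proof -
  have "pochhammer (- (1 / 2) :: real) (Suc n) = - (1 / 2) * pochhammer (1 / 2) n"
    by (simp add: pochhammer_rec)
  then show ?thesis
    unfolding sqrt_coeff_def gbinomial_alternating_pochhammer
    by (simp add: divide_nonpos_pos pochhammer_nonneg)
qed

lemma sum_sqrt_coeff_nonneg: "0 \<le> (\<Sum>k\<le>n. sqrt_coeff k)"
proof -
  have "(\<Sum>k\<le>n. sqrt_coeff k) = (-1) ^ n * ((1 / 2 - 1) gchoose n)"
    using gbinomial_sum_lower_neg[of "1 / 2 :: real" n] by (simp add: sqrt_coeff_def mult.commute)
  also have "\<dots> = pochhammer (1 / 2) n / fact n"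
    by (subst gbinomial_alternating_pochhammer) simp
  also have "\<dots> \<ge> 0" by (simp add: pochhammer_nonneg)
  finally show ?thesis .
qed

lemma sum_abs_sqrt_coeff_Suc: "(\<Sum>k<n. \<bar>sqrt_coeff (Suc k)\<bar>) \<le> 1"
proof -
  have "(\<Sum>k<n. \<bar>sqrt_coeff (Suc k)\<bar>) = - (\<Sum>k<n. sqrt_coeff (Suc k))"
    by (simp add: sqrt_coeff_Suc_nonpos sum_negf)
  also have "\<dots> = 1 - (\<Sum>k\<le>n. sqrt_coeff k)"
    by (simp add: sum.atMost_shift)
  finally show ?thesis using sum_sqrt_coeff_nonneg[of n] by simp
qed

lemma summable_abs_sqrt_coeff_Suc: "summable (\<lambda>n. \<bar>sqrt_coeff (Suc n)\<bar>)"
  by (rule summableI_nonneg_bounded[where x = 1]) (simp_all add: sum_abs_sqrt_coeff_Suc)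

text \<open>Vandermonde's identity with both upper indices \<open>1 / 2\<close>: the square of the series is \<open>1 - t\<close>.\<close>

lemma sqrt_coeff_convolution:
  "(\<Sum>k\<le>n. sqrt_coeff k * sqrt_coeff (n - k)) = (if n = 0 then 1 else if n = 1 then -1 else 0)"
proof -
  have "(\<Sum>k\<le>n. sqrt_coeff k * sqrt_coeff (n - k))
      = (\<Sum>k\<le>n. (-1) ^ n * (((1 / 2) gchoose k) * ((1 / 2) gchoose (n - k))))"
  proof (rule sum.cong)
    fix k assume "k \<in> {..n}"
    then have "(-1) ^ n = (-1) ^ k * (-1::real) ^ (n - k)" by (simp flip: power_add)
    then show "sqrt_coeff k * sqrt_coeff (n - k)
        = (-1) ^ n * (((1 / 2) gchoose k) * ((1 / 2) gchoose (n - k)))"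
      by (simp add: sqrt_coeff_def)
  qed simp
  also have "\<dots> = (-1) ^ n * ((1 / 2 + 1 / 2 :: real) gchoose n)"
    using gbinomial_Vandermonde[of "1 / 2 :: real" "1 / 2" n]
    by (simp only: sum_distrib_left[symmetric] atLeast0AtMost)
  also have "\<dots> = (-1) ^ n * real (1 choose n)"
    by (simp add: binomial_gbinomial)
  also have "\<dots> = (if n = 0 then 1 else if n = 1 then -1 else 0)"
    by simp
  finally show ?thesis .
qed

definition sqrt_one_minus :: "'a::{real_normed_algebra_1,banach} \<Rightarrow> 'a" where
  "sqrt_one_minus x = (\<Sum>n. sqrt_coeff n *\<^sub>R x ^ n)"

context
  fixes x :: "'a::{real_normed_algebra_1,banach}"
  assumes x: "norm x \<le> 1"
begin

lemma norm_sqrt_series_term: "norm (sqrt_coeff n *\<^sub>R x ^ n) \<le> \<bar>sqrt_coeff n\<bar>"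
proof -
  have "norm (x ^ n) \<le> 1"
    using norm_power_ineq[of x n] power_le_one[of "norm x" n] x by simp
  then show ?thesis by (simp add: mult_left_le)
qed

lemma summable_norm_sqrt_series: "summable (\<lambda>n. norm (sqrt_coeff n *\<^sub>R x ^ n))"
proof (rule summable_comparison_test')
  show "summable (\<lambda>n. \<bar>sqrt_coeff n\<bar>)"
    using summable_abs_sqrt_coeff_Suc summable_Suc_iff by blast
qed (use norm_sqrt_series_term in simp)

lemma sums_sqrt_one_minus: "(\<lambda>n. sqrt_coeff n *\<^sub>R x ^ n) sums sqrt_one_minus x"
  unfolding sqrt_one_minus_def
  by (rule summable_sums[OF summable_norm_cancel[OF summable_norm_sqrt_series]])

lemma sqrt_one_minus_square: "sqrt_one_minus x * sqrt_one_minus x = 1 - x"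
proof -
  have "(\<lambda>n. \<Sum>k\<le>n. (sqrt_coeff k *\<^sub>R x ^ k) * (sqrt_coeff (n - k) *\<^sub>R x ^ (n - k)))
      sums (sqrt_one_minus x * sqrt_one_minus x)"
    unfolding sqrt_one_minus_def
    by (rule Cauchy_product_sums[OF summable_norm_sqrt_series summable_norm_sqrt_series])
  moreover have "(\<Sum>k\<le>n. (sqrt_coeff k *\<^sub>R x ^ k) * (sqrt_coeff (n - k) *\<^sub>R x ^ (n - k)))
      = (if n = 0 then 1 else if n = 1 then - x else 0)" (is "?l = ?r") for n
  proof -
    have "?l = (\<Sum>k\<le>n. (sqrt_coeff k * sqrt_coeff (n - k)) *\<^sub>R x ^ n)"
      by (intro sum.cong) (simp_all flip: power_add)
    also have "\<dots> = ?r"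
      by (simp add: sqrt_coeff_convolution flip: scaleR_sum_left)
    finally show ?thesis .
  qed
  moreover have "(\<lambda>n. if n = 0 then 1 else if n = 1 then - x else 0) sums
      (\<Sum>n\<in>{..1}. if n = 0 then 1 else if n = (1::nat) then - x else 0)"
    by (rule sums_finite) auto
  ultimately show ?thesis
    using sums_unique2[of _ "sqrt_one_minus x * sqrt_one_minus x"] by simp
qed

lemma norm_one_minus_sqrt_one_minus: "norm (1 - sqrt_one_minus x) \<le> 1"
proof -
  let ?f = "\<lambda>n. sqrt_coeff (Suc n) *\<^sub>R x ^ Suc n"
  have "sqrt_one_minus x = suminf ?f + 1"
    using suminf_split_head[OF sums_summable[OF sums_sqrt_one_minus]]
    by (simp add: sqrt_one_minus_def)
  moreover have "norm (suminf ?f) \<le> (\<Sum>n. \<bar>sqrt_coeff (Suc n)\<bar>)"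
    by (rule norm_suminf_le[OF norm_sqrt_series_term summable_abs_sqrt_coeff_Suc])
  moreover have "(\<Sum>n. \<bar>sqrt_coeff (Suc n)\<bar>) \<le> 1"
    by (rule suminf_le_const[OF summable_abs_sqrt_coeff_Suc sum_abs_sqrt_coeff_Suc])
  ultimately show ?thesis by (simp add: algebra_simps)
qed

lemma sqrt_one_minus_commute:
  assumes "z * x = x * z"
  shows "z * sqrt_one_minus x = sqrt_one_minus x * z"
proof -
  have "z * x ^ n = x ^ n * z" for n
    using power_commuting_commutes[of x z n] assms by simp
  then have "(\<lambda>n. z * (sqrt_coeff n *\<^sub>R x ^ n)) = (\<lambda>n. (sqrt_coeff n *\<^sub>R x ^ n) * z)"
    by simp
  then show ?thesis
    using sums_mult[OF sums_sqrt_one_minus, of z] sums_mult2[OF sums_sqrt_one_minus, of z]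
    by (metis sums_unique2)
qed

end

lemma star_sqrt_one_minus:
  fixes x :: "'a::{cstar_algebra,real_normed_algebra_1}"
  assumes "norm x \<le> 1" "star x = x"
  shows "star (sqrt_one_minus x) = sqrt_one_minus x"
  using bounded_linear.sums[OF bounded_linear_star sums_sqrt_one_minus[OF assms(1)]]
    sums_sqrt_one_minus[OF assms(1)]
  by (simp add: star_scaleR star_power assms(2) sums_unique2)

section \<open>Order in the commutative algebra generated by a self-adjoint element\<close>

text \<open>The self-adjoint part of the double commutant replaces the real closed subalgebra generated by
  \<open>s\<close>: for self-adjoint \<open>s\<close> it is commutative as well, and it contains the sum of every convergent power
  series in its elements without an approximation argument.\<close>

definition functions_of :: "'a::cstar_algebra \<Rightarrow> 'a set" where
  "functions_of s = {x. star x = x \<and> (\<forall>z. z * s = s * z \<longrightarrow> z * x = x * z)}"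

definition squares_of :: "'a::cstar_algebra \<Rightarrow> 'a set" where
  "squares_of s = (\<lambda>y. y * y) ` functions_of s"

context
  fixes s :: "'a::{cstar_algebra,real_normed_algebra_1}"
  assumes s: "star s = s"
begin

lemma functions_of_star: "x \<in> functions_of s \<Longrightarrow> star x = x"
  by (simp add: functions_of_def)

lemma functions_of_commute:
  assumes "x \<in> functions_of s" "y \<in> functions_of s"
  shows "x * y = y * x"
proof -
  have "s * x = x * s" using assms(1) by (simp add: functions_of_def)
  then show ?thesis using assms(2) by (simp add: functions_of_def)
qed

lemma functions_of_generator: "s \<in> functions_of s"
  using s by (simp add: functions_of_def)

lemma functions_of_one: "1 \<in> functions_of s"
  by (simp add: functions_of_def)

lemma functions_of_add: "x \<in> functions_of s \<Longrightarrow> y \<in> functions_of s \<Longrightarrow> x + y \<in> functions_of s"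
  by (simp add: functions_of_def star_add distrib_left distrib_right)

lemma functions_of_scaleR: "x \<in> functions_of s \<Longrightarrow> r *\<^sub>R x \<in> functions_of s"
  by (simp add: functions_of_def star_scaleR)

lemma functions_of_diff: "x \<in> functions_of s \<Longrightarrow> y \<in> functions_of s \<Longrightarrow> x - y \<in> functions_of s"
  using functions_of_add[of x "(-1) *\<^sub>R y"] functions_of_scaleR[of y "-1"] by simp

lemma functions_of_of_real: "of_real r \<in> functions_of s"
  by (simp add: of_real_def functions_of_scaleR functions_of_one)

lemma functions_of_mult:
  assumes "x \<in> functions_of s" "y \<in> functions_of s"
  shows "x * y \<in> functions_of s"
proof -
  have "z * (x * y) = x * y * z" if "z * s = s * z" for z
  proof -
    have "z * x = x * z" "z * y = y * z"
      using assms that unfolding functions_of_def by blast+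
    then show ?thesis by (metis mult.assoc)
  qed
  moreover have "star (x * y) = x * y"
    unfolding star_mult functions_of_star[OF assms(1)] functions_of_star[OF assms(2)]
    by (rule functions_of_commute[OF assms(2,1)])
  ultimately show ?thesis unfolding functions_of_def by blast
qed

lemma functions_of_sqrt_one_minus:
  "x \<in> functions_of s \<Longrightarrow> norm x \<le> 1 \<Longrightarrow> sqrt_one_minus x \<in> functions_of s"
  unfolding functions_of_def using star_sqrt_one_minus sqrt_one_minus_commute by blast

lemmas functions_of_intros = functions_of_generator functions_of_one functions_of_add
  functions_of_scaleR functions_of_diff functions_of_of_real functions_of_mult
  functions_of_sqrt_one_minus

lemma squares_of_functions: "x \<in> squares_of s \<Longrightarrow> x \<in> functions_of s"
  by (auto simp: squares_of_def functions_of_mult)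

text \<open>The element \<open>u = x + i g\<close> satisfies \<open>star u * u = M\<^sup>2\<close>, so it has norm \<open>M\<close>, and \<open>x\<close> is its real
  part.\<close>

lemma norm_le_of_sum_squares:
  assumes x: "x \<in> functions_of s" and g: "g \<in> functions_of s"
    and eq: "x * x + g * g = of_real (M\<^sup>2)" and "0 \<le> M"
  shows "norm x \<le> M"
proof -
  define u where "u = x + \<i> *\<^sub>C g"
  have [simp]: "star x = x" "star g = g" "g * x = x * g"
    using x g functions_of_star functions_of_commute by auto
  have su: "star u = x - \<i> *\<^sub>C g"
    by (simp add: u_def star_add star_scaleC scaleC_minus_left)
  have "\<i> *\<^sub>C \<i> *\<^sub>C (g * g) = - (g * g)"
    by (simp add: scaleC_scaleC scaleC_minus_left scaleC_one)
  then have "star u * u = of_real (M\<^sup>2)"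
    unfolding su eq[symmetric]
    by (simp add: u_def algebra_simps mult_scaleC_left mult_scaleC_right scaleC_diff_right)
  then have "(norm u)\<^sup>2 = M\<^sup>2"
    using cstar_identity[of u] by (simp del: of_real_power)
  then have "norm u = M"
    using \<open>0 \<le> M\<close> by (simp add: power2_eq_iff_nonneg)
  moreover have "2 *\<^sub>R x = u + star u"
    unfolding su by (simp add: u_def scaleR_2)
  then have "2 * norm x \<le> norm u + norm (star u)"
    by (metis norm_scaleR norm_triangle_ineq abs_numeral)
  ultimately show ?thesis by simp
qed

text \<open>The root is \<open>sqrt M\<close> times the binomial series at \<open>1 - x / M\<close>. The last estimate has the same
  shape as the hypothesis, so that a root can be extracted from the root again.\<close>

lemma exists_root:
  assumes x: "x \<in> functions_of s" and n: "norm (of_real M - x) \<le> M" and M: "0 < M"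
  obtains y where "y \<in> functions_of s" "y * y = x" "norm (of_real (sqrt M) - y) \<le> sqrt M"
proof
  define z where "z = (1 / M) *\<^sub>R (of_real M - x)"
  define y where "y = sqrt M *\<^sub>R sqrt_one_minus z"
  have z: "norm z \<le> 1" "z \<in> functions_of s"
    using n M by (auto simp: z_def intro!: functions_of_intros x)
  show "y \<in> functions_of s"
    unfolding y_def using z by (intro functions_of_intros)
  have "y * y = M *\<^sub>R (1 - z)"
    using M z by (simp add: y_def sqrt_one_minus_square)
  also have "\<dots> = x"
    using M by (simp add: z_def algebra_simps of_real_def)
  finally show "y * y = x" .
  have "of_real (sqrt M) - y = sqrt M *\<^sub>R (1 - sqrt_one_minus z)"
    by (simp add: y_def algebra_simps of_real_def)
  then show "norm (of_real (sqrt M) - y) \<le> sqrt M"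
    using norm_one_minus_sqrt_one_minus[OF z(1)] M by (simp add: mult_left_le)
qed

lemma squares_ofI:
  assumes "x \<in> functions_of s" "norm (of_real M - x) \<le> M"
  shows "x \<in> squares_of s"
proof (cases "M = 0")
  case True
  then have "x = (0 *\<^sub>R s) * (0 *\<^sub>R s)" using assms by simp
  then show ?thesis
    unfolding squares_of_def by (rule image_eqI) (intro functions_of_intros)
next
  case False
  with assms(2) have "0 < M" using norm_ge_zero[of "of_real M - x"] by linarith
  with assms show ?thesis
    using exists_root[of x M] by (auto simp: squares_of_def)
qed

text \<open>If \<open>x = y\<^sup>2\<close> and \<open>M - x = g\<^sup>2\<close>, then \<open>y\<^sup>2 + g\<^sup>2 = M\<close> bounds \<open>g\<close> by \<open>sqrt M\<close>. Together with the
  converse above this describes the squares by a norm inequality, from which it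
  follows that they form a cone.\<close>

lemma squares_ofD:
  assumes "x \<in> squares_of s" "norm x \<le> M"
  shows "norm (of_real M - x) \<le> M"
proof (cases "M = 0")
  case False
  with assms(2) have M: "0 < M" using norm_ge_zero[of x] by linarith
  obtain y where y: "y \<in> functions_of s" "x = y * y"
    using assms(1) by (auto simp: squares_of_def)
  have "norm (of_real M - (of_real M - x)) \<le> M" using assms(2) by simp
  then obtain g where g: "g \<in> functions_of s" "g * g = of_real M - x"
    using exists_root[of "of_real M - x" M] M assms(1)
    by (metis functions_of_diff functions_of_of_real squares_of_functions)
  have "norm g \<le> sqrt M"
    by (rule norm_le_of_sum_squares[OF g(1) y(1)]) (use g y M in simp_all)
  then have "(norm g)\<^sup>2 \<le> M"
    using M by (metis norm_ge_zero power_mono real_sqrt_pow2 less_imp_le)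
  then show ?thesis
    using norm_selfadjoint_square[OF functions_of_star[OF g(1)]] g(2) by simp
qed (use assms in simp)

lemma exists_square_root_square:
  assumes "x \<in> squares_of s"
  obtains p where "p \<in> squares_of s" "p * p = x"
proof -
  have "norm (of_real (norm x + 1) - x) \<le> norm x + 1"
    by (rule squares_ofD[OF assms]) simp
  then show ?thesis
    using exists_root[of x "norm x + 1"] that squares_ofI assms
    by (metis squares_of_functions norm_ge_zero add_nonneg_pos zero_less_one)
qed

lemma squares_of_add:
  assumes "x \<in> squares_of s" "y \<in> squares_of s"
  shows "x + y \<in> squares_of s"
proof (rule squares_ofI)
  have "of_real (norm x + norm y) - (x + y) = (of_real (norm x) - x) + (of_real (norm y) - y)"
    by simp
  then show "norm (of_real (norm x + norm y) - (x + y)) \<le> norm x + norm y"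
    using norm_triangle_le add_mono[OF squares_ofD[OF assms(1) order_refl] squares_ofD[OF assms(2) order_refl]]
    by metis
qed (use assms in \<open>auto intro: functions_of_add squares_of_functions\<close>)

lemma squares_of_mult:
  assumes "x \<in> squares_of s" "y \<in> squares_of s"
  shows "x * y \<in> squares_of s"
proof -
  obtain a b where ab: "a \<in> functions_of s" "x = a * a" "b \<in> functions_of s" "y = b * b"
    using assms by (auto simp: squares_of_def)
  then have "x * y = (a * b) * (a * b)"
    using functions_of_commute[of a b] by (metis mult.assoc)
  then show ?thesis
    using ab by (auto simp: squares_of_def intro: functions_of_mult)
qed

lemma squares_of_scaleR:
  assumes "x \<in> squares_of s" "0 \<le> r"
  shows "r *\<^sub>R x \<in> squares_of s"
proof -
  obtain a where a: "a \<in> functions_of s" "x = a * a"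
    using assms by (auto simp: squares_of_def)
  then have "r *\<^sub>R x = (sqrt r *\<^sub>R a) * (sqrt r *\<^sub>R a)"
    using assms(2) by simp
  then show ?thesis
    unfolding squares_of_def by (rule image_eqI) (intro functions_of_scaleR a)
qed

text \<open>If \<open>g\<^sup>2 = (M - x) * (M + x)\<close>, then \<open>x\<^sup>2 + g\<^sup>2 = M\<^sup>2\<close>.\<close>

lemma norm_le_of_squares:
  assumes x: "x \<in> functions_of s" and "of_real M - x \<in> squares_of s" "of_real M + x \<in> squares_of s"
    and "0 \<le> M"
  shows "norm x \<le> M"
proof -
  have "(of_real M - x) * (of_real M + x) \<in> squares_of s"
    using assms by (intro squares_of_mult)
  then obtain g where g: "g \<in> functions_of s" "(of_real M - x) * (of_real M + x) = g * g"
    by (auto simp: squares_of_def)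
  have "of_real M * x = x * of_real M"
    by (simp add: of_real_def)
  then have "x * x + g * g = of_real (M\<^sup>2)"
    unfolding g(2)[symmetric] by (simp add: algebra_simps power2_eq_square)
  then show ?thesis
    by (rule norm_le_of_sum_squares[OF x g(1) _ \<open>0 \<le> M\<close>])
qed

lemma squares_of_antisym:
  assumes "x \<in> squares_of s" "- x \<in> squares_of s"
  shows "x = 0"
  using norm_le_of_squares[of x 0] assms squares_of_functions by auto

lemma norm_power_two_power:
  assumes "x \<in> functions_of s"
  shows "norm (x ^ (2 ^ k)) = norm x ^ (2 ^ k)"
proof (induction k)
  case (Suc k)
  have "star (x ^ (2 ^ k)) = x ^ (2 ^ k)"
    using functions_of_star[OF assms] by (simp add: star_power)
  then have "norm (x ^ (2 ^ k) * x ^ (2 ^ k)) = (norm (x ^ (2 ^ k)))\<^sup>2"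
    by (rule norm_selfadjoint_square)
  with Suc show ?case
    by (simp add: power_even_eq power2_eq_square power_add[symmetric] mult_2)
qed simp

text \<open>This is what makes positive parts squares. Orthogonality gives
  \<open>(1 - a - b)\<^sup>n = (1 - a)\<^sup>n + (1 - b)\<^sup>n - 1\<close>, and on multiples of \<open>a\<close> the powers of \<open>1 - a - b\<close>
  and of \<open>1 - a\<close> coincide. So the powers of \<open>1 - a\<close> remain bounded; but for a self-adjoint element of
  norm greater than one the norms of the powers with exponent \<open>2\<^sup>k\<close> grow without bound.\<close>

lemma one_minus_contraction_of_orthogonal:
  assumes a: "a \<in> functions_of s" and b: "b \<in> functions_of s"
    and ab: "a * b = 0" and n: "norm (1 - a - b) \<le> 1"
  shows "norm (1 - a) \<le> 1"
proof (rule ccontr)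
  assume "\<not> norm (1 - a) \<le> 1"
  then obtain k where k: "3 < norm (1 - a) ^ k"
    using real_arch_pow[of "norm (1 - a)" 3] by auto
  define N where "N = (2::nat) ^ k"
  \<comment> \<open>A multiple of \<open>a\<close>, hence orthogonal to \<open>b\<close>; its norm is controlled through \<open>u\<^sup>2\<close>.\<close>
  define u where "u = 1 - (1 - a) ^ N"
  have pb: "(1 - a) ^ j * b = b" for j
    by (induction j) (simp_all add: power_Suc2 mult.assoc left_diff_distrib ab del: power_Suc)
  have ub: "u * b = 0" by (simp add: u_def left_diff_distrib pb)
  have "u * (1 - a - b) ^ j = u * (1 - a) ^ j" for j
  proof (induction j)
    case (Suc j)
    have "u * (1 - a - b) ^ Suc j = u * (1 - a) ^ j * (1 - a) - u * ((1 - a) ^ j * b)"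
      by (simp add: power_Suc2 mult.assoc[symmetric] Suc right_diff_distrib del: power_Suc)
    then show ?case
      by (simp add: pb ub power_Suc2 mult.assoc del: power_Suc)
  qed simp
  from this[of N] have "u * u = u * (1 - (1 - a - b) ^ N)"
    by (simp add: right_diff_distrib) (simp add: u_def algebra_simps)
  moreover have "norm (1 - (1 - a - b) ^ N) \<le> 2"
    using norm_triangle_ineq4[of 1 "(1 - a - b) ^ N"] norm_power_ineq[of "1 - a - b" N]
      power_le_one[of "norm (1 - a - b)" N] n by simp
  ultimately have "norm (u * u) \<le> norm u * 2"
    by (metis norm_mult_ineq mult_left_mono norm_ge_zero order_trans)
  moreover have "star u = u"
    using functions_of_star[OF a] by (simp add: u_def star_diff star_power)
  ultimately have "norm u \<le> 2"
    using norm_selfadjoint_square[of u] by (cases "u = 0") (simp_all add: power2_eq_square)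
  then have "norm ((1 - a) ^ N) \<le> 3"
    using norm_triangle_ineq4[of 1 u] by (simp add: u_def)
  then have "norm (1 - a) ^ N \<le> 3"
    unfolding N_def by (simp add: norm_power_two_power functions_of_intros a)
  moreover have "norm (1 - a) ^ k \<le> norm (1 - a) ^ N"
    using \<open>\<not> norm (1 - a) \<le> 1\<close> less_exp[of k] by (intro power_increasing) (auto simp: N_def)
  ultimately show False using k by simp
qed

text \<open>Here \<open>p\<close> is the absolute value of \<open>x\<close>. The positive and negative parts of \<open>x\<close> are orthogonal because
  \<open>(p + x) * (p - x) = p\<^sup>2 - x\<^sup>2\<close>, and their sum is the square \<open>p\<close>.\<close>

lemma half_abs_add_in_squares:
  assumes p: "p \<in> squares_of s" and x: "x \<in> functions_of s" and eq: "p * p = x * x"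
  shows "(1 / 2) *\<^sub>R (p + x) \<in> squares_of s"
proof -
  define M where "M = norm p + 1"
  define a where "a = (1 / (2 * M)) *\<^sub>R (p + x)"
  define b where "b = (1 / (2 * M)) *\<^sub>R (p - x)"
  have M: "0 < M" by (simp add: M_def add_nonneg_pos)
  have F: "a \<in> functions_of s" "b \<in> functions_of s"
    unfolding a_def b_def by (intro functions_of_intros squares_of_functions[OF p] x)+
  have "x * p = p * x"
    using p x functions_of_commute squares_of_functions by blast
  then have ab: "a * b = 0"
    by (simp add: a_def b_def algebra_simps eq)
  have "norm (of_real M - p) \<le> M"
    by (rule squares_ofD[OF p]) (simp add: M_def)
  moreover have sum: "a + b = (1 / M) *\<^sub>R p"
    using M by (simp add: a_def b_def algebra_simps flip: scaleR_add_left)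
  have "1 - a - b = (1 / M) *\<^sub>R (of_real M - p)"
    unfolding diff_diff_eq sum using M by (simp add: of_real_def algebra_simps)
  ultimately have "norm (1 - a - b) \<le> 1"
    using M by simp
  then have "norm (of_real 1 - a) \<le> 1"
    using one_minus_contraction_of_orthogonal[OF F ab] by simp
  then have "a \<in> squares_of s"
    by (rule squares_ofI[OF F(1)])
  then have "M *\<^sub>R a \<in> squares_of s"
    using M by (intro squares_of_scaleR) auto
  then show ?thesis using M by (simp add: a_def)
qed

lemma orthogonal_decomposition:
  assumes x: "x \<in> functions_of s"
  obtains a b where "a \<in> squares_of s" "b \<in> squares_of s" "a - b = x" "a * b = 0"
proof -
  have "x * x \<in> squares_of s" using x by (auto simp: squares_of_def)
  then obtain p where p: "p \<in> squares_of s" "p * p = x * x"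
    by (rule exists_square_root_square)
  have x': "- x \<in> functions_of s" using functions_of_scaleR[OF x, of "-1"] by simp
  have "x * p = p * x"
    using p x functions_of_commute squares_of_functions by blast
  then have "((1 / 2) *\<^sub>R (p + x)) * ((1 / 2) *\<^sub>R (p + - x)) = 0"
    by (simp add: algebra_simps p(2))
  moreover have "(1 / 2) *\<^sub>R (p + x) - (1 / 2) *\<^sub>R (p + - x) = x"
    by (simp add: algebra_simps flip: scaleR_add_left)
  ultimately show ?thesis
    using that half_abs_add_in_squares[OF p(1) x p(2)] half_abs_add_in_squares[OF p(1) x'] p(2)
    by simp
qed

text \<open>Complete the square: \<open>(y - 1 / 2)\<^sup>2 + (y - y\<^sup>2) = 1 / 4\<close> gives \<open>\<parallel>y - 1 / 2\<parallel> \<le> 1 / 2\<close>.\<close>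

lemma between_zero_and_one:
  assumes y: "y \<in> functions_of s" and "y - y * y \<in> squares_of s"
  shows "norm y \<le> 1" "norm (1 - y) \<le> 1"
proof -
  obtain g where g: "g \<in> functions_of s" "y - y * y = g * g"
    using assms(2) by (auto simp: squares_of_def)
  define x where "x = y - of_real (1 / 2)"
  have "norm x \<le> 1 / 2"
  proof (rule norm_le_of_sum_squares)
    show "x \<in> functions_of s" unfolding x_def using y by (intro functions_of_intros)
    have "x * x = of_real ((1 / 2)\<^sup>2) - (y - y * y)"
      unfolding x_def by (simp add: of_real_def algebra_simps power2_eq_square)
        (simp flip: scaleR_add_left)
    then show "x * x + g * g = of_real ((1 / 2)\<^sup>2)"
      unfolding g(2) by simp
  qed (use g in simp_all)
  moreover have "norm (of_real (1 / 2) :: 'a) = 1 / 2"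
    by (simp only: norm_of_real)
  ultimately have "norm (x + of_real (1 / 2)) \<le> 1" "norm (of_real (1 / 2) - x) \<le> 1"
    using norm_triangle_ineq[of x "of_real (1 / 2)"] norm_triangle_ineq4[of "of_real (1 / 2)" x]
    by linarith+
  moreover have "y = x + of_real (1 / 2)" "1 - y = of_real (1 / 2) - x"
    by (simp_all add: x_def of_real_def algebra_simps flip: scaleR_add_left)
  ultimately show "norm y \<le> 1" "norm (1 - y) \<le> 1"
    by (simp_all only:)
qed

text \<open>As functions of \<open>t = p / d \<ge> 0\<close>, \<open>n\<close> and \<open>b\<close> are the positive and negative parts of \<open>1 - t\<close>, and \<open>m\<close>
  and \<open>c\<close> are those of \<open>1 - b\<close>. So \<open>n\<close> lives on \<open>t \<le> 1\<close>, where \<open>m\<close> is \<open>1\<close>, while \<open>m\<close> lives on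
  \<open>t \<le> 2\<close>; the bumps \<open>n\<close> and \<open>m\<close> around \<open>t = 0\<close> are the complements of the cut-offs sought.
  The decompositions themselves are part of the conclusion because they determine the values of \<open>n\<close> and
  \<open>m\<close> under characters.\<close>

lemma nested_cutoffs:
  assumes p: "p \<in> squares_of s" and d: "0 < d"
  obtains n b m c where
    "n \<in> squares_of s" "b \<in> squares_of s" "n - b = 1 - (1 / d) *\<^sub>R p" "n * b = 0"
    "m \<in> squares_of s" "c \<in> squares_of s" "m - c = 1 - b" "m * c = 0"
    "norm (1 - n) \<le> 1" "norm m \<le> 1" "norm (1 - m) \<le> 1" "n * m = n" "norm (m * p) \<le> 2 * d"
proof -
  have pF: "p \<in> functions_of s" by (rule squares_of_functions[OF p])
  have "1 - (1 / d) *\<^sub>R p \<in> functions_of s"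
    using pF by (intro functions_of_intros)
  then obtain n b where n: "n \<in> squares_of s" and b: "b \<in> squares_of s"
    and nb: "n - b = 1 - (1 / d) *\<^sub>R p" "n * b = 0"
    by (rule orthogonal_decomposition)
  have F1: "n \<in> functions_of s" "b \<in> functions_of s"
    using n b by (auto intro: squares_of_functions)
  then have "1 - b \<in> functions_of s" by (intro functions_of_intros)
  then obtain m c where m: "m \<in> squares_of s" and c: "c \<in> squares_of s"
    and mc: "m - c = 1 - b" "m * c = 0"
    by (rule orthogonal_decomposition)
  have F2: "m \<in> functions_of s" "c \<in> functions_of s"
    using m c by (auto intro: squares_of_functions)
  have "n - n * n = n - n * (n - b)"
    by (simp add: right_diff_distrib nb(2))
  also have "\<dots> = (1 / d) *\<^sub>R (n * p)"
    unfolding nb(1) by (simp add: right_diff_distrib)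
  finally have "n - n * n \<in> squares_of s"
    using n p d by (simp add: squares_of_scaleR squares_of_mult)
  note nbounds = between_zero_and_one[OF F1(1) this]
  have mm: "m - m * m = m * b"
  proof -
    have "m * m = m * (m - c)" by (simp add: right_diff_distrib mc(2))
    then show ?thesis unfolding mc(1) by (simp add: right_diff_distrib)
  qed
  then have "m - m * m \<in> squares_of s"
    using m b by (simp add: squares_of_mult)
  note mbounds = between_zero_and_one[OF F2(1) this]
  have nm: "n * m = n"
  proof -
    have *: "n * m - n * c = n"
      using arg_cong[OF mc(1), of "\<lambda>z. n * z"] by (simp add: right_diff_distrib nb(2))
    have "n * c = (n * m - n * c) * c" by (simp add: *)
    also have "\<dots> = - (n * c * c)"
      by (simp add: left_diff_distrib mult.assoc mc(2))
    \<comment> \<open>Both \<open>n * c\<close> and its negative are squares.\<close>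
    finally have "- (n * c) = - (- (n * c * c))" by (rule arg_cong[where f = uminus])
    then have "- (n * c) = n * c * c" by (simp only: minus_minus)
    moreover have "n * c \<in> squares_of s" "n * c * c \<in> squares_of s"
      by (intro squares_of_mult n c)+
    ultimately have "n * c = 0"
      by (intro squares_of_antisym) simp_all
    with * show ?thesis by simp
  qed
  have "norm (m * p) \<le> 2 * d"
  proof (rule norm_le_of_squares)
    have mn: "m * n = n * m" by (rule functions_of_commute[OF F2(1) F1(1)])
    have "(1 / d) *\<^sub>R p = 1 - n + b" using nb(1) by (simp add: algebra_simps)
    then have "d *\<^sub>R (1 / d) *\<^sub>R p = d *\<^sub>R (1 - n + b)" by simp
    then have "p = d *\<^sub>R (1 - n + b)" using d by simp
    then have "m * p = m * (d *\<^sub>R (1 - n + b))" by simp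
    also have "\<dots> = d *\<^sub>R (m - m * n + m * b)"
      by (simp add: right_diff_distrib distrib_left)
    finally have mp: "m * p = d *\<^sub>R (m - m * n + m * b)" .
    have "d *\<^sub>R e + d *\<^sub>R e - m * p = d *\<^sub>R ((e - m) + (e - m) + (m * n + m * m))" for e
      unfolding mp mm[symmetric] by (simp add: algebra_simps)
    then have eq: "of_real (2 * d) - m * p = d *\<^sub>R ((1 - m) + (1 - m) + (m * n + m * m))"
      by (metis scaleR_add_left mult_2 of_real_def)
    have "1 - m \<in> squares_of s"
      by (rule squares_ofI[where M = 1]) (use mbounds F2 in \<open>simp_all add: functions_of_intros\<close>)
    then show "of_real (2 * d) - m * p \<in> squares_of s"
      unfolding eq using m n d
      by (intro squares_of_scaleR squares_of_add squares_of_mult) simp_all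
    have "of_real (2 * d) \<in> squares_of s"
      by (rule squares_ofI[OF functions_of_of_real, where M = "2 * d"]) (use d in simp)
    then show "of_real (2 * d) + m * p \<in> squares_of s"
      using m p by (intro squares_of_add squares_of_mult)
  qed (use F2 pF d in \<open>auto intro: functions_of_intros\<close>)
  then show ?thesis
    by (rule that[OF n b nb m c mc nbounds(2) mbounds nm])
qed

end


section \<open>Approximate units with a local unit\<close>

text \<open>The scalar part is a character of the unitization with kernel \<open>A\<close>, so elements of \<open>A\<close> are
  recognised by its value.\<close>

lemma scalar_part_square:
  assumes "X \<in> squares_of S"
  shows "scalar_part X \<in> \<real>\<^sub>\<ge>\<^sub>0"
proof -
  obtain Y where Y: "star Y = Y" "X = Y * Y"
    using assms unfolding squares_of_def functions_of_def by blast
  have "cnj (scalar_part Y) = scalar_part Y"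
    using arg_cong[OF Y(1), of scalar_part] unfolding unitization_star_simps .
  then show ?thesis
    using Y(2) by (auto simp: complex_nonneg_Reals_iff complex_eq_iff)
qed

text \<open>Characters send orthogonal decompositions to orthogonal decompositions of real numbers, and that of
  \<open>1\<close> is \<open>1 - 0\<close>.\<close>

lemma scalar_part_orthogonal:
  assumes "N \<in> squares_of S" "B \<in> squares_of S" "N * B = 0"
    and eq: "scalar_part N - scalar_part B = 1"
  shows "scalar_part N = 1" "scalar_part B = 0"
proof -
  have "scalar_part N * scalar_part B = 0"
    using arg_cong[OF assms(3), of scalar_part] by simp
  moreover have "scalar_part N \<noteq> 0"
  proof
    assume "scalar_part N = 0"
    then have "- Re (scalar_part B) = 1" using arg_cong[OF eq, of Re] by simp
    then show False using scalar_part_square[OF assms(2)] by (simp add: complex_nonneg_Reals_iff)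
  qed
  ultimately show "scalar_part B = 0" by simp
  then show "scalar_part N = 1" using eq by simp
qed

lemma embed_diff: "embed (x - y) = embed x - embed y"
  and embed_mult: "embed (x * y) = embed x * embed y"
  and embed_star: "embed (star x) = star (embed x)"
  by (auto intro!: unitization.expand)

lemma embed_algebra_part: "scalar_part X = 0 \<Longrightarrow> embed (algebra_part X) = X"
  by (intro unitization.expand) simp

lemma norm_mult_star_self: "norm (x * star x) = (norm (x::'a::cstar_algebra))\<^sup>2"
  using cstar_identity[of "star x"] by (simp add: star_star)

text \<open>Apply the cut-offs to \<open>p = s\<^sup>2\<close> with \<open>s = a * star a\<close>, and take \<open>y = 1 - m\<close>, \<open>h = 1 - n\<close>. Both
  have scalar part \<open>0\<close>, so they belong to \<open>A\<close>, and \<open>h * y = y\<close> is equivalent to \<open>n * m = n\<close>. Using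
  \<open>s\<^sup>2\<close>, a square by construction, dispenses with the theorem that \<open>a * star a\<close> is positive. Since
  \<open>\<parallel>m * a\<parallel>\<^sup>2 \<le> \<parallel>m * s\<parallel>\<close> and \<open>\<parallel>m * s\<parallel>\<^sup>2 \<le> \<parallel>m * p\<parallel> \<le> 2 * d\<close>, the choice \<open>2 * d = e\<^sup>4\<close> is the right one.\<close>

proposition approximate_unit_with_local_unit:
  fixes a :: "'a::cstar_algebra"
  assumes e: "0 < e"
  obtains y h where "star y = y" "norm y \<le> 1" "norm h \<le> 1" "h * y = y" "norm (y * a - a) \<le> e"
proof -
  define A where "A = embed a"
  define S where "S = A * star A"
  define P where "P = S * S"
  define d where "d = e ^ 4 / 2"
  have S: "star S = S" by (simp add: S_def star_mult star_star)
  have [simp]: "scalar_part P = 0" by (simp add: P_def S_def A_def)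
  have P: "P \<in> squares_of S"
    unfolding P_def squares_of_def using functions_of_generator[OF S] by blast
  have d: "0 < d" using e by (simp add: d_def)
  obtain N B M C where N: "N \<in> squares_of S" "B \<in> squares_of S" "N - B = 1 - (1 / d) *\<^sub>R P" "N * B = 0"
    and M: "M \<in> squares_of S" "C \<in> squares_of S" "M - C = 1 - B" "M * C = 0"
    and norms: "norm (1 - N) \<le> 1" "norm M \<le> 1" "norm (1 - M) \<le> 1" "norm (M * P) \<le> 2 * d"
    and NM: "N * M = N"
    by (rule nested_cutoffs[OF S P d])
  have "scalar_part N - scalar_part B = 1"
    using arg_cong[OF N(3), of scalar_part] by simp
  note sN = scalar_part_orthogonal[OF N(1,2,4) this]
  have "scalar_part M - scalar_part C = 1"
    using arg_cong[OF M(3), of scalar_part] sN by simp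
  note sM = scalar_part_orthogonal(1)[OF M(1,2,4) this]
  have starM: "star M = M"
    by (rule functions_of_star[OF S squares_of_functions[OF S M(1)]])
  define y where "y = algebra_part (1 - M)"
  define h where "h = algebra_part (1 - N)"
  have y: "embed y = 1 - M" and h: "embed h = 1 - N"
    unfolding y_def h_def by (rule embed_algebra_part, simp add: sM sN)+
  have "embed (star y) = embed y"
    by (simp only: embed_star y star_diff star_one starM)
  moreover have "embed (h * y) = embed y"
    unfolding embed_mult h y by (simp add: left_diff_distrib right_diff_distrib NM)
  moreover have "norm y \<le> 1" "norm h \<le> 1"
    using norms norm_embed[of y] norm_embed[of h] by (simp_all add: y h)
  moreover have "norm (y * a - a) \<le> e"
  proof -
    have "norm (y * a - a) = norm (embed (y * a - a))" by simp
    also have "embed (y * a - a) = - (M * A)"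
      unfolding embed_diff embed_mult y A_def[symmetric] by (simp add: left_diff_distrib)
    finally have ya: "norm (y * a - a) = norm (M * A)" by simp
    have contract: "norm (X * M) \<le> norm X" for X
      using norm_mult_ineq[of X M] norms(2) mult_left_le[of "norm M" "norm X"] by simp
    have "(norm (M * A))\<^sup>2 = norm (M * S * M)"
      unfolding norm_mult_star_self[symmetric] by (simp add: star_mult starM S_def mult.assoc)
    also have "\<dots> \<le> norm (M * S)" by (rule contract)
    finally have 1: "(norm (M * A))\<^sup>2 \<le> norm (M * S)" .
    have "(norm (M * S))\<^sup>2 = norm (M * P * M)"
      unfolding norm_mult_star_self[symmetric] by (simp add: star_mult starM S P_def mult.assoc)
    also have "\<dots> \<le> norm (M * P)" by (rule contract)
    also have "\<dots> \<le> (e\<^sup>2)\<^sup>2" using norms(4) by (simp add: d_def flip: power_mult)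
    finally have "norm (M * S) \<le> e\<^sup>2" by (rule power2_le_imp_le) simp
    with 1 have "(norm (M * A))\<^sup>2 \<le> e\<^sup>2" by simp
    then show ?thesis unfolding ya by (rule power2_le_imp_le) (use e in simp)
  qed
  ultimately show ?thesis
    by (intro that[of y h]) simp_all
qed

section \<open>Positive linear functionals\<close>

locale positive_linear_functional =
  fixes \<Phi> :: "'a::cstar_algebra \<Rightarrow> complex"
  assumes add: "\<Phi> (x + y) = \<Phi> x + \<Phi> y"
    and scaleC: "\<Phi> (c *\<^sub>C x) = c * \<Phi> x"
    and positive: "positive_functional \<Phi>"
begin

lemma diff: "\<Phi> (x - y) = \<Phi> x - \<Phi> y"
  using add[of "x - y" y] by simp

lemma scaleR: "\<Phi> (r *\<^sub>R x) = complex_of_real r * \<Phi> x"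
  using scaleC[of "complex_of_real r" x] by (simp add: scaleC_of_real)

lemma star_self: "Im (\<Phi> (star x * x)) = 0" "0 \<le> Re (\<Phi> (star x * x))"
  using positive by (auto simp: positive_functional_def complex_nonneg_Reals_iff)

lemma star_self_of_real: "\<Phi> (star x * x) = complex_of_real (Re (\<Phi> (star x * x)))"
  by (simp add: complex_eq_iff star_self)

lemma expand:
  "\<Phi> (star (x + c *\<^sub>C y) * (x + c *\<^sub>C y)) = \<Phi> (star x * x) + c * \<Phi> (star x * y)
     + cnj c * \<Phi> (star y * x) + complex_of_real ((cmod c)\<^sup>2) * \<Phi> (star y * y)"
proof -
  have "star (x + c *\<^sub>C y) * (x + c *\<^sub>C y) = star x * x + c *\<^sub>C (star x * y)
     + cnj c *\<^sub>C (star y * x) + (cnj c * c) *\<^sub>C (star y * y)"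
    by (simp add: star_add star_scaleC distrib_left distrib_right mult_scaleC_left mult_scaleC_right
        scaleC_scaleC scaleC_add_right algebra_simps)
  moreover have "cnj c * c = complex_of_real ((cmod c)\<^sup>2)"
    by (metis complex_norm_square mult.commute)
  ultimately show ?thesis by (simp add: add scaleC)
qed

text \<open>Polarization with \<open>c = 1\<close> and \<open>c = \<i>\<close>.\<close>

lemma hermitian: "\<Phi> (star y * x) = cnj (\<Phi> (star x * y))"
proof -
  have "Im (\<Phi> (star x * y) + \<Phi> (star y * x)) = 0"
    using arg_cong[OF expand[of x 1 y], of Im] by (simp add: star_self)
  moreover have "Im (\<i> * \<Phi> (star x * y) - \<i> * \<Phi> (star y * x)) = 0"
    using arg_cong[OF expand[of x \<i> y], of Im] by (simp add: star_self)
  ultimately show ?thesis by (simp add: complex_eq_iff)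
qed

lemma Cauchy_Schwarz:
  "(cmod (\<Phi> (star x * y)))\<^sup>2 \<le> Re (\<Phi> (star x * x)) * Re (\<Phi> (star y * y))"
proof -
  define z where "z = \<Phi> (star x * y)"
  define Z where "Z = (cmod z)\<^sup>2"
  define A where "A = Re (\<Phi> (star x * x))"
  define B where "B = Re (\<Phi> (star y * y))"
  have quad: "0 \<le> A - 2 * t * Z + t\<^sup>2 * Z * B" for t
  proof -
    \<comment> \<open>The phase of \<open>c\<close> makes the mixed terms of the quadratic form real and negative for \<open>t > 0\<close>.\<close>
    define c where "c = - (complex_of_real t * cnj z)"
    have zz: "z * cnj z = complex_of_real Z"
      unfolding Z_def by (rule complex_norm_square[symmetric])
    have "c * z = - complex_of_real (t * Z)"
      unfolding of_real_mult zz[symmetric] c_def by simp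
    then have "Re (c * z) = - (t * Z)" "Re (cnj c * cnj z) = - (t * Z)"
      by (simp_all flip: complex_cnj_mult)
    moreover have "(cmod c)\<^sup>2 = t\<^sup>2 * Z"
      by (simp add: c_def norm_mult power_mult_distrib Z_def)
    ultimately show ?thesis
      using star_self(2)[of "x + c *\<^sub>C y"] unfolding expand hermitian[of y x] z_def[symmetric]
      by (simp add: A_def B_def mult_ac)
  qed
  have "Z \<le> A * B"
  proof (cases "B = 0")
    case True
    have "Z = 0"
    proof (rule ccontr)
      assume "Z \<noteq> 0"
      then show False using quad[of "(A + 1) / (2 * Z)"] True by simp
    qed
    then show ?thesis using True by simp
  next
    case False
    then have B: "0 < B" using star_self(2)[of y] by (simp add: B_def)
    have "0 \<le> A - 2 * (1 / B) * Z + (1 / B)\<^sup>2 * Z * B" by (rule quad)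
    also have "\<dots> = A - Z / B" using B by (simp add: power2_eq_square)
    finally show ?thesis using B by (simp add: field_simps)
  qed
  then show ?thesis by (simp add: Z_def z_def A_def B_def)
qed

end

lemma positive_linear_functional_state:
  "\<psi> \<in> states \<Longrightarrow> positive_linear_functional \<psi>"
  by unfold_locales
    (auto simp: states_def continuous_dual_def linear_add[OF bounded_linear.linear])

lemma norm_state_le:
  assumes "\<psi> \<in> states"
  shows "cmod (\<psi> x) \<le> norm x"
  using onorm[of \<psi> x] assms by (simp add: states_def continuous_dual_def)

text \<open>With a unit this is the Cauchy-Schwarz inequality for \<open>1\<close> and \<open>a\<close>; in general the unit is replaced by
  a contraction \<open>y\<close> with \<open>y * a\<close> close to \<open>a\<close>.\<close>

lemma state_square_le:
  assumes "\<psi> \<in> states"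
  shows "(cmod (\<psi> a))\<^sup>2 \<le> Re (\<psi> (star a * a))"
proof -
  interpret positive_linear_functional \<psi>
    by (rule positive_linear_functional_state[OF assms])
  let ?R = "Re (\<psi> (star a * a))"
  have "cmod (\<psi> a) \<le> sqrt ?R"
  proof (rule field_le_epsilon)
    fix e :: real
    assume "0 < e"
    then obtain y h where y: "star y = y" "norm y \<le> 1" and ya: "norm (y * a - a) \<le> e"
      by (rule approximate_unit_with_local_unit)
    have "Re (\<psi> (y * y)) \<le> norm (y * y)"
      using norm_state_le[OF assms] complex_Re_le_cmod order_trans by blast
    also have "\<dots> \<le> 1"
      using y by (simp add: norm_selfadjoint_square power_le_one)
    finally have "(cmod (\<psi> (y * a)))\<^sup>2 \<le> 1 * ?R"
      using Cauchy_Schwarz[of y a] star_self(2)[of a] y(1)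
      by (metis mult_right_mono order_trans)
    then have "cmod (\<psi> (y * a)) \<le> sqrt ?R" by (simp add: real_le_rsqrt)
    moreover have "cmod (\<psi> a) \<le> cmod (\<psi> (y * a)) + cmod (\<psi> (y * a - a))"
      using norm_triangle_ineq4[of "\<psi> (y * a)" "\<psi> (y * a - a)"] by (simp add: diff)
    ultimately show "cmod (\<psi> a) \<le> sqrt ?R + e"
      using norm_state_le[OF assms, of "y * a - a"] ya by linarith
  qed
  then have "(cmod (\<psi> a))\<^sup>2 \<le> (sqrt ?R)\<^sup>2" by (rule power_mono) simp
  then show ?thesis using star_self(2)[of a] by simp
qed

lemma state_star:
  assumes "\<psi> \<in> states"
  shows "\<psi> (star a) = cnj (\<psi> a)"
proof -
  interpret positive_linear_functional \<psi>
    by (rule positive_linear_functional_state[OF assms])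
  have "cmod (\<psi> (star a) - cnj (\<psi> a)) \<le> 0 + e" if "0 < e" for e
  proof -
    have "0 < e / 2" using that by simp
    then obtain y h where y: "star y = y" and ya: "norm (y * a - a) \<le> e / 2"
      by (rule approximate_unit_with_local_unit)
    have "\<psi> (star a * y) = cnj (\<psi> (y * a))"
      using hermitian[of a y] y by simp
    then have "\<psi> (star a) - cnj (\<psi> a) = cnj (\<psi> (y * a - a)) - \<psi> (star (y * a - a))"
      by (simp add: star_diff star_mult y diff)
    also have "cmod \<dots> \<le> norm (y * a - a) + norm (y * a - a)"
      by (rule norm_triangle_le_diff, rule add_mono)
        (use norm_state_le[OF assms, of "y * a - a"] norm_state_le[OF assms, of "star (y * a - a)"]
          in simp_all)
    finally show ?thesis using ya by simp
  qed
  then have "cmod (\<psi> (star a) - cnj (\<psi> a)) \<le> 0"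
    by (rule field_le_epsilon)
  then show ?thesis by simp
qed

definition unitized :: "('a::cstar_algebra \<Rightarrow> complex) \<Rightarrow> 'a unitization \<Rightarrow> complex" where
  "unitized \<psi> X = \<psi> (algebra_part X) + scalar_part X"

lemma unitized_simps:
  assumes "\<psi> \<in> states"
  shows "unitized \<psi> (embed x) = \<psi> x" "unitized \<psi> 1 = 1"
proof -
  interpret positive_linear_functional \<psi>
    by (rule positive_linear_functional_state[OF assms])
  show "unitized \<psi> (embed x) = \<psi> x" "unitized \<psi> 1 = 1"
    using scaleC[of 0 0] by (simp_all add: unitized_def)
qed

text \<open>For \<open>X = x + l\<close> the value at \<open>star X * X\<close> is
  \<open>\<psi> (star x * x) + 2 * Re (cnj l * \<psi> x) + \<bar>l\<bar>\<^sup>2\<close>, which is at least \<open>(\<bar>\<psi> x\<bar> - \<bar>l\<bar>)\<^sup>2\<close> by the previous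
  inequality.\<close>

lemma positive_linear_functional_unitized:
  assumes "\<psi> \<in> states"
  shows "positive_linear_functional (unitized \<psi>)"
proof -
  interpret positive_linear_functional \<psi>
    by (rule positive_linear_functional_state[OF assms])
  show ?thesis
  proof
    show "positive_functional (unitized \<psi>)"
      unfolding positive_functional_def
    proof
      fix X :: "'a unitization"
      define x l where "x = algebra_part X" and "l = scalar_part X"
      define R where "R = Re (\<psi> (star x * x))"
      define w where "w = cnj l * \<psi> x"
      have "unitized \<psi> (star X * X)
          = \<psi> (star x * x) + cnj l * \<psi> x + l * \<psi> (star x) + cnj l * l"
        by (simp add: unitized_def add scaleC x_def l_def)
      also have "\<dots> = complex_of_real R + (w + cnj w) + complex_of_real ((cmod l)\<^sup>2)"
        unfolding state_star[OF assms] R_def w_def star_self_of_real[symmetric]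
        using complex_norm_square[of l] by (simp add: mult.commute)
      also have "\<dots> = complex_of_real (R + 2 * Re w + (cmod l)\<^sup>2)"
        by (simp add: complex_eq_iff)
      finally have eq: "unitized \<psi> (star X * X) = complex_of_real (R + 2 * Re w + (cmod l)\<^sup>2)" .
      have "- Re w \<le> cmod l * cmod (\<psi> x)"
        using abs_Re_le_cmod[of w] by (simp add: w_def norm_mult)
      moreover have "(cmod (\<psi> x))\<^sup>2 \<le> R"
        unfolding R_def by (rule state_square_le[OF assms])
      moreover have "0 \<le> (cmod (\<psi> x) - cmod l)\<^sup>2" by simp
      ultimately have "0 \<le> R + 2 * Re w + (cmod l)\<^sup>2"
        by (simp add: power2_diff algebra_simps)
      then show "unitized \<psi> (star X * X) \<in> \<real>\<^sub>\<ge>\<^sub>0" unfolding eq nonneg_Reals_of_real_iff .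
    qed
  qed (simp_all add: unitized_def add scaleC algebra_simps)
qed

section \<open>Compressions of positive functionals\<close>

context
  fixes \<Phi> :: "'a::{cstar_algebra,real_normed_algebra_1} \<Rightarrow> complex"
  assumes plf: "positive_linear_functional \<Phi>" and unit: "\<Phi> 1 = 1"
begin

interpretation positive_linear_functional \<Phi> by (rule plf)

text \<open>The element \<open>\<parallel>x\<parallel>\<^sup>2 - star x * x\<close> is a square \<open>k\<^sup>2\<close>, and \<open>\<Phi>\<close> is nonnegative at
  \<open>star (k * b) * (k * b)\<close>.\<close>

lemma positive_functional_contraction:
  "Re (\<Phi> (star (x * b) * (x * b))) \<le> (norm x)\<^sup>2 * Re (\<Phi> (star b * b))"
proof -
  define z where "z = star x * x"
  have z: "star z = z" by (simp add: z_def star_mult star_star)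
  have "of_real ((norm x)\<^sup>2) - z \<in> squares_of z"
  proof (rule squares_ofI[OF z])
    show "of_real ((norm x)\<^sup>2) - z \<in> functions_of z"
      by (intro functions_of_diff functions_of_of_real functions_of_generator z)
    show "norm (of_real ((norm x)\<^sup>2) - (of_real ((norm x)\<^sup>2) - z)) \<le> (norm x)\<^sup>2"
      using cstar_identity[of x] by (simp add: z_def)
  qed
  then obtain k where k: "star k = k" "of_real ((norm x)\<^sup>2) - z = k * k"
    unfolding squares_of_def functions_of_def by blast
  have "star (k * b) * (k * b) = star b * (k * k) * b"
    by (simp add: star_mult k(1) mult.assoc)
  also have "\<dots> = (norm x)\<^sup>2 *\<^sub>R (star b * b) - star (x * b) * (x * b)"
    unfolding k(2)[symmetric]
    by (simp add: of_real_def left_diff_distrib right_diff_distrib z_def star_mult mult.assoc)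
  finally show ?thesis
    using star_self(2)[of "k * b"] by (simp add: diff scaleR)
qed

context
  fixes b :: 'a
  assumes b: "star b = b" "norm b \<le> 1"
begin

lemma Re_square_le_one: "Re (\<Phi> (b * b)) \<le> 1"
proof -
  have "Re (\<Phi> (b * b)) \<le> (norm b)\<^sup>2"
    using positive_functional_contraction[of b 1] by (simp add: b unit)
  then show ?thesis using b(2) by (simp add: power_le_one order_trans)
qed

lemma compression_bound: "cmod (\<Phi> (b * x * b)) \<le> norm x * Re (\<Phi> (b * b))"
proof (rule power2_le_imp_le)
  have nn: "0 \<le> Re (\<Phi> (b * b))" using star_self(2)[of b] b(1) by simp
  have "(cmod (\<Phi> (b * x * b)))\<^sup>2 \<le> Re (\<Phi> (b * b)) * Re (\<Phi> (star (x * b) * (x * b)))"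
    using Cauchy_Schwarz[of b "x * b"] by (simp add: b(1) mult.assoc)
  also have "\<dots> \<le> Re (\<Phi> (b * b)) * ((norm x)\<^sup>2 * Re (\<Phi> (b * b)))"
    using positive_functional_contraction[of x b] nn by (simp add: b(1) mult_left_mono)
  finally show "(cmod (\<Phi> (b * x * b)))\<^sup>2 \<le> (norm x * Re (\<Phi> (b * b)))\<^sup>2"
    by (simp add: power2_eq_square mult_ac)
  show "0 \<le> norm x * Re (\<Phi> (b * b))" using nn by simp
qed

text \<open>Split \<open>x - b * x * b = (1 - b) * x + b * x * (1 - b)\<close>; in each summand the Cauchy-Schwarz inequality
  separates the factor \<open>1 - b\<close>.\<close>

lemma compression_close:
  "cmod (\<Phi> (b * x * b) - \<Phi> x) \<le> 2 * norm x * sqrt (Re (\<Phi> ((1 - b) * (1 - b))))"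
proof -
  define t where "t = Re (\<Phi> ((1 - b) * (1 - b)))"
  have sb: "star (1 - b) = 1 - b" by (simp add: star_diff b(1))
  have t: "0 \<le> t" using star_self(2)[of "1 - b"] by (simp add: t_def sb)
  have "(cmod (\<Phi> ((1 - b) * x)))\<^sup>2 \<le> t * Re (\<Phi> (star x * x))"
    using Cauchy_Schwarz[of "1 - b" x] by (simp add: sb t_def)
  also have "\<dots> \<le> t * (norm x)\<^sup>2"
    using positive_functional_contraction[of x 1] t by (simp add: unit mult_left_mono)
  also have "\<dots> = (norm x * sqrt t)\<^sup>2" using t by (simp add: power_mult_distrib)
  finally have 1: "cmod (\<Phi> ((1 - b) * x)) \<le> norm x * sqrt t"
    by (rule power2_le_imp_le) (use t in simp)
  have "(cmod (\<Phi> (b * x * (1 - b))))\<^sup>2 \<le> Re (\<Phi> (star (star x * b) * (star x * b))) * t"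
    using Cauchy_Schwarz[of "star x * b" "1 - b"] by (simp add: sb t_def star_mult star_star b(1))
  also have "\<dots> \<le> ((norm x)\<^sup>2 * Re (\<Phi> (b * b))) * t"
    using positive_functional_contraction[of "star x" b] t by (simp add: b(1) mult_right_mono)
  also have "\<dots> \<le> (norm x)\<^sup>2 * t"
    using Re_square_le_one t by (simp add: mult_left_le mult_right_mono)
  also have "\<dots> = (norm x * sqrt t)\<^sup>2" using t by (simp add: power_mult_distrib)
  finally have 2: "cmod (\<Phi> (b * x * (1 - b))) \<le> norm x * sqrt t"
    by (rule power2_le_imp_le) (use t in simp)
  have "x - b * x * b = (1 - b) * x + b * x * (1 - b)"
    by (simp add: algebra_simps)
  then have "\<Phi> x - \<Phi> (b * x * b) = \<Phi> ((1 - b) * x) + \<Phi> (b * x * (1 - b))"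
    by (simp only: add[symmetric] diff[symmetric])
  then have "cmod (\<Phi> x - \<Phi> (b * x * b)) \<le> norm x * sqrt t + norm x * sqrt t"
    using norm_triangle_mono[OF 1 2] by simp
  then show ?thesis
    by (simp add: t_def norm_minus_commute)
qed

text \<open>Squaring a cut-off turns a lower bound for \<open>\<Phi> (b\<^sup>2)\<close>, which the Cauchy-Schwarz inequality
  provides, into smallness of the defect.\<close>

lemma defect_of_square:
  "Re (\<Phi> ((1 - b * b) * (1 - b * b))) \<le> 2 * (1 - Re (\<Phi> (b * b)))"
proof -
  have "Re (\<Phi> (b * b * (b * b))) \<le> (norm b)\<^sup>2 * Re (\<Phi> (b * b))"
    using positive_functional_contraction[of b b] by (simp add: star_mult b(1))
  also have "\<dots> \<le> 1 * 1"
    using Re_square_le_one b star_self(2)[of b] by (intro mult_mono) (simp_all add: power_le_one)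
  finally have "Re (\<Phi> (b * b * (b * b))) \<le> 1" by simp
  moreover have "(1 - b * b) * (1 - b * b) = 1 - b * b - b * b + b * b * (b * b)"
    by (simp add: algebra_simps)
  ultimately show ?thesis by (simp add: add diff unit)
qed

end

end

lemma exists_almost_norming:
  assumes "\<psi> \<in> states" "0 < \<eta>"
  obtains a where "norm a = 1" "1 - \<eta> < cmod (\<psi> a)"
proof -
  have \<psi>: "bounded_linear \<psi>" "onorm \<psi> = 1"
    using assms(1) by (auto simp: states_def continuous_dual_def)
  have "\<exists>a. (1 - \<eta>) * norm a < cmod (\<psi> a)"
  proof (rule ccontr)
    assume "\<nexists>a. (1 - \<eta>) * norm a < cmod (\<psi> a)"
    then have "cmod (\<psi> a) \<le> (1 - \<eta>) * norm a" for a by (meson not_less)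
    then have "cmod (\<psi> a) \<le> max 0 (1 - \<eta>) * norm a" for a
      by (rule order_trans) (simp add: mult_right_mono)
    then have "onorm \<psi> \<le> max 0 (1 - \<eta>)" by (intro onorm_bound) simp_all
    then show False using \<psi>(2) assms(2) by simp
  qed
  then obtain a where a: "(1 - \<eta>) * norm a < cmod (\<psi> a)" ..
  then have "a \<noteq> 0" using linear_0[OF bounded_linear.linear[OF \<psi>(1)]] by auto
  show ?thesis
  proof
    show "norm ((1 / norm a) *\<^sub>R a) = 1" using \<open>a \<noteq> 0\<close> by simp
    have "\<psi> ((1 / norm a) *\<^sub>R a) = (1 / norm a) *\<^sub>R \<psi> a"
      by (rule linear_scale[OF bounded_linear.linear[OF \<psi>(1)]])
    then show "1 - \<eta> < cmod (\<psi> ((1 / norm a) *\<^sub>R a))"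
      using a \<open>a \<noteq> 0\<close> by (simp add: field_simps)
  qed
qed

text \<open>Normalization by \<open>K\<close> gives \<open>\<phi> h = \<psi> (b * b) / K = 1\<close>, so \<open>h\<close> witnesses both that the functional has
  norm one and that it is compactly supported.\<close>

lemma compressed_state:
  fixes \<psi> :: "'a::cstar_algebra \<Rightarrow> complex"
  assumes \<psi>: "\<psi> \<in> states" and b: "star b = b" "norm b \<le> 1" and h: "norm h \<le> 1" "h * b = b"
    and K: "Re (\<psi> (b * b)) = K" "0 < K"
  shows "(\<lambda>x. \<psi> (b * x * b) / complex_of_real K) \<in> compactly_supported_states"
proof -
  interpret positive_linear_functional \<psi>
    by (rule positive_linear_functional_state[OF \<psi>])
  define \<phi> where "\<phi> x = \<psi> (b * x * b) / complex_of_real K" for x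
  have B: "star (embed b) = embed b" "norm (embed b) \<le> 1"
    using b by (simp_all flip: embed_star)
  have "cmod (\<psi> (b * x * b)) \<le> norm x * K" for x
    using compression_bound[OF positive_linear_functional_unitized[OF \<psi>] unitized_simps(2)[OF \<psi>] B, of "embed x"]
    by (simp add: unitized_simps[OF \<psi>] K flip: embed_mult)
  then have bound: "cmod (\<phi> x) \<le> norm x" for x
    using K(2) by (simp add: \<phi>_def norm_divide field_simps)
  have lin: "\<phi> (x + y) = \<phi> x + \<phi> y" "\<phi> (c *\<^sub>C x) = c * \<phi> x" "\<phi> (r *\<^sub>R x) = r *\<^sub>R \<phi> x"
    for x y c r
    by (simp_all add: \<phi>_def distrib_left distrib_right add add_divide_distrib mult_scaleC_left
        mult_scaleC_right scaleC scaleR scaleR_conv_of_real)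
  have bl: "bounded_linear \<phi>"
    by (rule bounded_linear_intro[where K = 1]) (simp_all add: lin bound)
  have "\<phi> (star x * x) = complex_of_real (Re (\<psi> (star (x * b) * (x * b))) / K)" for x
    using star_self_of_real[of "x * b"] by (simp add: \<phi>_def star_mult b(1) mult.assoc)
  then have pos: "positive_functional \<phi>"
    using K(2) star_self(2)
    by (simp add: positive_functional_def divide_nonneg_pos del: of_real_divide)
  have "\<psi> (b * b) = complex_of_real K"
    using star_self_of_real[of b] by (simp add: b(1) K)
  then have \<phi>h: "\<phi> h = 1"
    using K(2) h(2) by (simp add: \<phi>_def mult.assoc)
  then have norm_h: "norm h = 1"
    using bound[of h] h(1) by simp
  have "onorm \<phi> = 1"
  proof (rule antisym)
    show "onorm \<phi> \<le> 1" by (rule onorm_bound) (simp_all add: bound)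
    show "1 \<le> onorm \<phi>" using onorm[OF bl, of h] by (simp add: \<phi>h norm_h)
  qed
  then have "\<phi> \<in> states"
    using bl pos lin by (simp add: states_def continuous_dual_def)
  moreover have "h \<noteq> 0" "\<phi> h = complex_of_real (norm h)"
    using norm_h \<phi>h by auto
  ultimately have "\<phi> \<in> compactly_supported_states"
    by (auto simp: compactly_supported_states_def)
  then show ?thesis by (simp add: \<phi>_def[abs_def])
qed

text \<open>If \<open>\<bar>\<psi> a\<bar> > 1 - \<eta>\<close> and \<open>y * a\<close> is \<open>\<eta>\<close>-close to \<open>a\<close>, then
  \<open>\<psi> (y\<^sup>2) \<ge> \<bar>\<psi> (y * a)\<bar>\<^sup>2 \<ge> 1 - 4 * \<eta>\<close>, so the defect \<open>t\<close> of \<open>b = y\<^sup>2\<close> is at most \<open>8 * \<eta>\<close>.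
  Compressing by \<open>b\<close> and normalizing each move the state by at most \<open>2 * sqrt t\<close> in norm.\<close>

proposition compactly_supported_states_norm_dense:
  fixes \<psi> :: "'a::cstar_algebra \<Rightarrow> complex"
  assumes \<psi>: "\<psi> \<in> states" and r: "0 < r"
  shows "\<exists>\<phi>\<in>compactly_supported_states. \<forall>x. cmod (\<phi> x - \<psi> x) \<le> r * norm x"
proof -
  interpret positive_linear_functional \<psi>
    by (rule positive_linear_functional_state[OF \<psi>])
  note U = positive_linear_functional_unitized[OF \<psi>] unitized_simps(2)[OF \<psi>]
  \<comment> \<open>The second bound makes \<open>4 * sqrt (8 * \<eta>) \<le> r\<close>; the first keeps \<open>\<psi> b\<close> away from \<open>0\<close>.\<close>
  define \<eta> where "\<eta> = min (1 / 8) (r\<^sup>2 / 128)"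
  have \<eta>: "0 < \<eta>" "\<eta> \<le> 1 / 8" "128 * \<eta> \<le> r\<^sup>2"
    using r by (auto simp: \<eta>_def)
  obtain a where a: "norm a = 1" "1 - \<eta> < cmod (\<psi> a)"
    using exists_almost_norming[OF \<psi> \<eta>(1)] .
  obtain y h where y: "star y = y" "norm y \<le> 1" and h: "norm h \<le> 1" "h * y = y"
    and ya: "norm (y * a - a) \<le> \<eta>"
    using approximate_unit_with_local_unit[OF \<eta>(1)] .
  define b where "b = y * y"
  define K where "K = Re (\<psi> (b * b))"
  have b: "star b = b" "norm b \<le> 1" "h * b = b"
    using y h(2) by (simp_all add: b_def star_mult norm_selfadjoint_square power_le_one
        flip: mult.assoc)
  have Y: "star (embed y) = embed y" "norm (embed y) \<le> 1"
    and B: "star (embed b) = embed b" "norm (embed b) \<le> 1"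
    using b y by (simp_all flip: embed_star)
  have near: "1 - 4 * \<eta> \<le> Re (\<psi> b)"
  proof -
    have "cmod (\<psi> a) \<le> cmod (\<psi> (y * a)) + cmod (\<psi> (y * a - a))"
      using norm_triangle_ineq4[of "\<psi> (y * a)" "\<psi> (y * a - a)"] by (simp add: diff)
    then have "1 - 2 * \<eta> \<le> cmod (\<psi> (y * a))"
      using norm_state_le[OF \<psi>, of "y * a - a"] ya a(2) by linarith
    then have "(1 - 2 * \<eta>)\<^sup>2 \<le> (cmod (\<psi> (y * a)))\<^sup>2"
      using \<eta> by (intro power_mono) auto
    also have "\<dots> \<le> Re (\<psi> b) * Re (\<psi> (star a * a))"
      using Cauchy_Schwarz[of y a] by (simp add: y(1) b_def)
    also have "\<dots> \<le> Re (\<psi> b) * 1"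
    proof (rule mult_left_mono)
      show "Re (\<psi> (star a * a)) \<le> 1"
        using norm_state_le[OF \<psi>, of "star a * a"] complex_Re_le_cmod[of "\<psi> (star a * a)"]
          cstar_identity[of a] a(1) by simp
      show "0 \<le> Re (\<psi> b)" using star_self(2)[of y] by (simp add: y(1) b_def)
    qed
    finally have "(1 - 2 * \<eta>)\<^sup>2 \<le> Re (\<psi> b)" by simp
    moreover have "1 - 4 * \<eta> \<le> (1 - 2 * \<eta>)\<^sup>2" by (simp add: power2_diff)
    ultimately show ?thesis by linarith
  qed
  have Kpos: "0 < K"
  proof -
    have "Re (\<psi> b) \<le> cmod (\<psi> b)" by (rule complex_Re_le_cmod)
    then have "0 < cmod (\<psi> b)" using near \<eta> by linarith
    then have "0 < (cmod (\<psi> b))\<^sup>2" by simp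
    also have "\<dots> \<le> K" using state_square_le[OF \<psi>, of b] by (simp add: b K_def)
    finally show ?thesis .
  qed
  define t where "t = Re (unitized \<psi> ((1 - embed b) * (1 - embed b)))"
  have "t \<le> 2 * (1 - Re (\<psi> b))"
    using defect_of_square[OF U Y] by (simp add: t_def unitized_simps[OF \<psi>] b_def flip: embed_mult)
  also have "\<dots> \<le> 8 * \<eta>" using near by simp
  finally have "t \<le> 8 * \<eta>" .
  then have "sqrt t \<le> r / 4"
    using r \<eta>(3) by (intro real_le_lsqrt) (simp_all add: power_divide)
  then have t: "4 * sqrt t \<le> r" by simp
  have close: "cmod (\<psi> (b * x * b) - \<psi> x) \<le> 2 * norm x * sqrt t" for x
    using compression_close[OF U B, of "embed x"]
    by (simp add: unitized_simps[OF \<psi>] t_def flip: embed_mult)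
  have bound: "cmod (\<psi> (b * x * b)) \<le> norm x * K" for x
    using compression_bound[OF U B, of "embed x"]
    by (simp add: unitized_simps[OF \<psi>] K_def flip: embed_mult)
  have K1: "\<bar>K - 1\<bar> \<le> 2 * sqrt t"
  proof -
    have "unitized \<psi> (embed b * 1 * embed b) = \<psi> (b * b)"
      by (simp add: unitized_simps[OF \<psi>] flip: embed_mult)
    then have "cmod (\<psi> (b * b) - 1) \<le> 2 * sqrt t"
      using compression_close[OF U B, of 1] by (simp add: unitized_simps[OF \<psi>] t_def)
    then show ?thesis
      using abs_Re_le_cmod[of "\<psi> (b * b) - 1"] by (simp add: K_def)
  qed
  show ?thesis
  proof (intro bexI allI)
    show "(\<lambda>x. \<psi> (b * x * b) / complex_of_real K) \<in> compactly_supported_states"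
      by (rule compressed_state[OF \<psi> b(1,2) h(1) b(3) K_def[symmetric] Kpos])
    fix x
    have "cmod (\<psi> (b * x * b) / complex_of_real K - \<psi> (b * x * b))
        = cmod (\<psi> (b * x * b)) / K * \<bar>K - 1\<bar>"
    proof -
      have "\<psi> (b * x * b) / complex_of_real K - \<psi> (b * x * b)
          = \<psi> (b * x * b) / complex_of_real K * complex_of_real (1 - K)"
        using Kpos by (simp add: field_simps)
      then show ?thesis
        using Kpos by (simp only: norm_mult norm_divide norm_of_real) (simp add: abs_minus_commute)
    qed
    also have "\<dots> \<le> norm x * (2 * sqrt t)"
      using bound[of x] Kpos K1 by (intro mult_mono) (simp_all add: field_simps)
    finally have "cmod (\<psi> (b * x * b) / complex_of_real K - \<psi> (b * x * b)
        + (\<psi> (b * x * b) - \<psi> x)) \<le> norm x * (2 * sqrt t) + 2 * norm x * sqrt t"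
      by (rule norm_triangle_mono[OF _ close[of x]])
    then have "cmod (\<psi> (b * x * b) / complex_of_real K - \<psi> x)
        \<le> norm x * (2 * sqrt t) + 2 * norm x * sqrt t"
      by simp
    also have "\<dots> = (4 * sqrt t) * norm x" by simp
    also have "\<dots> \<le> r * norm x" by (rule mult_right_mono[OF t]) simp
    finally show "cmod (\<psi> (b * x * b) / complex_of_real K - \<psi> x) \<le> r * norm x" .
  qed
qed

section \<open>Weak-* density\<close>

text \<open>The weak-* topology on the dual is coarser than the norm topology, so norm density suffices.\<close>

lemma weak_star_neighbourhood_contains_norm_ball:
  fixes \<psi> :: "'a::cstar_algebra \<Rightarrow> complex"
  assumes "openin weak_star_topology W" "\<psi> \<in> W"
  obtains r where "0 < r"
    "\<forall>\<phi>\<in>continuous_dual. (\<forall>x. cmod (\<phi> x - \<psi> x) \<le> r * norm x) \<longrightarrow> \<phi> \<in> W"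
proof -
  have "generate_topology_on {{\<phi> \<in> continuous_dual. \<phi> a \<in> U} | a U. open U} W"
    using assms(1) by (simp add: weak_star_topology_def openin_topology_generated_by)
  then have "\<psi> \<in> W \<longrightarrow> (\<exists>r>0. \<forall>\<phi>\<in>continuous_dual.
      (\<forall>x. cmod (\<phi> x - \<psi> x) \<le> r * norm x) \<longrightarrow> \<phi> \<in> W)"
  proof induction
    case (Int A B)
    show ?case
    proof
      assume "\<psi> \<in> A \<inter> B"
      then obtain r1 r2 where r: "0 < r1" "0 < r2"
        and A: "\<forall>\<phi>\<in>continuous_dual. (\<forall>x. cmod (\<phi> x - \<psi> x) \<le> r1 * norm x) \<longrightarrow> \<phi> \<in> A"
        and B: "\<forall>\<phi>\<in>continuous_dual. (\<forall>x. cmod (\<phi> x - \<psi> x) \<le> r2 * norm x) \<longrightarrow> \<phi> \<in> B"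
        using Int.IH by auto
      have "min r1 r2 * norm x \<le> r1 * norm x" "min r1 r2 * norm x \<le> r2 * norm x" for x :: 'a
        by (simp_all add: mult_right_mono)
      then have "\<forall>\<phi>\<in>continuous_dual. (\<forall>x. cmod (\<phi> x - \<psi> x) \<le> min r1 r2 * norm x) \<longrightarrow> \<phi> \<in> A \<inter> B"
        using A B by (meson IntI order_trans)
      then show "\<exists>r>0. \<forall>\<phi>\<in>continuous_dual. (\<forall>x. cmod (\<phi> x - \<psi> x) \<le> r * norm x) \<longrightarrow> \<phi> \<in> A \<inter> B"
        using r by (intro exI[of _ "min r1 r2"]) simp
    qed
  next
    case (UN \<A>)
    show ?case
    proof
      assume "\<psi> \<in> \<Union>\<A>"
      then obtain A where A: "A \<in> \<A>" "\<psi> \<in> A" by blast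
      with UN.IH[OF A(1)] obtain r where "0 < r"
        "\<forall>\<phi>\<in>continuous_dual. (\<forall>x. cmod (\<phi> x - \<psi> x) \<le> r * norm x) \<longrightarrow> \<phi> \<in> A"
        by blast
      with A(1) show "\<exists>r>0. \<forall>\<phi>\<in>continuous_dual.
          (\<forall>x. cmod (\<phi> x - \<psi> x) \<le> r * norm x) \<longrightarrow> \<phi> \<in> \<Union>\<A>"
        by (intro exI[of _ r]) blast
    qed
  next
    case (Basis s)
    then obtain a U where s: "s = {\<phi> \<in> continuous_dual. \<phi> a \<in> U}" "open U" by blast
    show ?case
    proof
      assume "\<psi> \<in> s"
      then obtain e where e: "0 < e" "ball (\<psi> a) e \<subseteq> U"
        using s openE by blast
      have "\<phi> \<in> s" if "\<phi> \<in> continuous_dual" "\<forall>x. cmod (\<phi> x - \<psi> x) \<le> e / (norm a + 1) * norm x" for \<phi>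
      proof -
        have "cmod (\<phi> a - \<psi> a) \<le> e / (norm a + 1) * norm a" using that(2) by blast
        also have "\<dots> < e" using e(1) by (simp add: pos_divide_less_eq add_nonneg_pos distrib_left)
        finally have "\<phi> a \<in> ball (\<psi> a) e" by (simp add: dist_norm norm_minus_commute)
        then show ?thesis using that(1) e(2) s(1) by blast
      qed
      moreover have "0 < e / (norm a + 1)" using e(1) by (simp add: add_nonneg_pos)
      ultimately show "\<exists>r>0. \<forall>\<phi>\<in>continuous_dual. (\<forall>x. cmod (\<phi> x - \<psi> x) \<le> r * norm x) \<longrightarrow> \<phi> \<in> s"
        by blast
    qed
  qed simp
  with assms(2) show ?thesis using that by blast
qed

lemma states_subset_topspace:
  "(states :: ('a::cstar_algebra \<Rightarrow> complex) set) \<subseteq> topspace weak_star_topology"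
proof -
  have "openin weak_star_topology {\<phi> \<in> continuous_dual. \<phi> (0::'a) \<in> UNIV}"
    unfolding weak_star_topology_def
    by (rule topology_generated_by_Basis) (use open_UNIV in blast)
  then have "{\<phi> \<in> continuous_dual. \<phi> (0::'a) \<in> UNIV} \<subseteq> topspace weak_star_topology"
    by (rule openin_subset)
  then show ?thesis by (auto simp: states_def)
qed

theorem propositionA34:
  shows "subtopology weak_star_topology (states :: ('a::cstar_algebra \<Rightarrow> complex) set)
           closure_of compactly_supported_states = states"
proof
  show "subtopology weak_star_topology (states :: ('a \<Rightarrow> complex) set)
      closure_of compactly_supported_states \<subseteq> states"
    using closure_of_subset_topspace[of "subtopology weak_star_topology (states :: ('a \<Rightarrow> complex) set)"]
    by (auto simp: topspace_subtopology)
  show "states \<subseteq> subtopology weak_star_topology (states :: ('a \<Rightarrow> complex) set)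
      closure_of compactly_supported_states"
  proof
    fix \<psi> :: "'a \<Rightarrow> complex"
    assume \<psi>: "\<psi> \<in> states"
    have "\<exists>\<phi>\<in>compactly_supported_states. \<phi> \<in> T"
      if T: "\<psi> \<in> T" "openin (subtopology weak_star_topology states) T" for T
    proof -
      obtain W where W: "openin weak_star_topology W" "T = W \<inter> states"
        using T(2) by (auto simp: openin_subtopology)
      have "\<psi> \<in> W" using T(1) W(2) by simp
      obtain r where r: "0 < r"
        "\<forall>\<phi>\<in>continuous_dual. (\<forall>x. cmod (\<phi> x - \<psi> x) \<le> r * norm x) \<longrightarrow> \<phi> \<in> W"
        by (rule weak_star_neighbourhood_contains_norm_ball[OF W(1) \<open>\<psi> \<in> W\<close>])
      obtain \<phi> where \<phi>: "\<phi> \<in> compactly_supported_states" "\<forall>x. cmod (\<phi> x - \<psi> x) \<le> r * norm x"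
        using compactly_supported_states_norm_dense[OF \<psi> r(1)] by blast
      from \<phi>(1) have "\<phi> \<in> states" "\<phi> \<in> continuous_dual"
        by (auto simp: compactly_supported_states_def states_def)
      moreover have "\<phi> \<in> W" using r(2) \<phi>(2) \<open>\<phi> \<in> continuous_dual\<close> by blast
      ultimately show ?thesis using \<phi>(1) W(2) by blast
    qed
    moreover have "\<psi> \<in> topspace (subtopology weak_star_topology states)"
      using \<psi> states_subset_topspace by (auto simp: topspace_subtopology)
    ultimately show "\<psi> \<in> subtopology weak_star_topology states closure_of compactly_supported_states"
      by (auto simp: in_closure_of)
  qed
qed

end
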